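(* Let $G=K(H,\mathcal{T})$ be a superkite graph whose supertail $\mathcal{T}=Q^s$ consists of $s\ge 2$ copies of a rooted tree $Q$, all with root identified with the same vertex $v\in V(H)$. Suppose $H$ is not a complete graph, let $k$ be an integer with $1\le k\le |V(H)|-1$ such that $\alpha(H)=\alpha(F_k(H))$, and suppose $$\lambda_1(L_{[V(H-v)]}(H))\ge \lambda_1(L_{[V(Q-v)]}(Q)).$$ Let $G^+$ be a graph obtained from $G$ by adding some edges to $H$. Then $\alpha(G^+)=\alpha(F_k(G^+))$.
   Context: A superkite graph $K(H,\mathcal{T})$ has head $H$ (an arbitrary graph) and supertail $\mathcal{T}=Q^s$ formed by $s\ge 2$ trees isomorphic to a rooted tree $Q$, pairwise disjoint except for their common root, which is the vertex $v\in V(H)$ (and otherwise disjoint from $H$); in $Q-v$, $v$ denotes the root of $Q$. For a graph $G$ and $V'\subseteq V(G)$, $L_{[V']}(G)$ is the principal submatrix of the Laplacian matrix $L(G)$ with rows and columns indexed by $V'$, and $\lambda_1(M)$ is the smallest eigenvalue of a symmetric matrix $M$. $\alpha(G)$ is the algebraic connectivity (second smallest Laplacian eigenvalue). For a graph $G=(V,E)$ on $n$ vertices and $1\le k\le n-1$, the $k$-token graph $F_k(G)$ has as vertices the $k$-subsets of $V$, two $k$-subsets being adjacent iff their symmetric difference is $\{a,b\}$ with $ab\in E$. *)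

theory Defs
  imports "Graph_Theory.Graph_Theory" "Jordan_Normal_Form.Char_Poly"
begin

text \<open>
  Finite simple undirected graphs are the symmetric loop-free pair digraphs of \<^locale>\<open>pair_graph\<close>:
  an edge \<open>uv\<close> is the pair of arcs \<open>(u, v)\<close> and \<open>(v, u)\<close>.
\<close>

section \<open>Laplacian matrices and their spectra\<close>

definition laplacian_entry :: "'a pair_pre_digraph \<Rightarrow> 'a \<Rightarrow> 'a \<Rightarrow> real" where
  "laplacian_entry G u v =
    (if u = v then real (out_degree (with_proj G) u) else 0) - (if (u, v) \<in> parcs G then 1 else 0)"

text \<open>
  The principal submatrix of the Laplacian of \<open>G\<close> on the rows and columns in \<open>V'\<close>; degrees are
  taken in all of \<open>G\<close>. The vertices are listed in an arbitrary order, on which the spectrum does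
  not depend.
\<close>

definition laplacian_on :: "'a set \<Rightarrow> 'a pair_pre_digraph \<Rightarrow> real mat" where
  "laplacian_on V' G =
    (let xs = (SOME xs. distinct xs \<and> set xs = V')
     in mat (card V') (card V') (\<lambda>(i, j). laplacian_entry G (xs ! i) (xs ! j)))"

definition laplacian :: "'a pair_pre_digraph \<Rightarrow> real mat" where
  "laplacian G = laplacian_on (pverts G) G"

text \<open>Meaningful for symmetric matrices of positive dimension.\<close>

definition min_eigenvalue :: "real mat \<Rightarrow> real" where
  "min_eigenvalue A = Min {\<mu>. eigenvalue A \<mu>}"

text \<open>All eigenvalues of a real symmetric matrix, increasingly and with multiplicity.\<close>

definition eigenvalue_list :: "real mat \<Rightarrow> real list" where
  "eigenvalue_list A = sorted_list_of_multiset (proots (char_poly A))"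

definition algebraic_connectivity :: "'a pair_pre_digraph \<Rightarrow> real" where
  "algebraic_connectivity G = eigenvalue_list (laplacian G) ! 1"


section \<open>Token graphs\<close>

definition token_graph :: "nat \<Rightarrow> 'a pair_pre_digraph \<Rightarrow> 'a set pair_pre_digraph" where
  "token_graph k G =
    (let W = {A. A \<subseteq> pverts G \<and> card A = k}
     in \<lparr> pverts = W,
          parcs = {(A, B). A \<in> W \<and> B \<in> W \<and>
                    (\<exists>a b. (a, b) \<in> parcs G \<and> (A - B) \<union> (B - A) = {a, b})} \<rparr>)"


section \<open>Superkite graphs\<close>

text \<open>
  \<^const>\<open>tree\<close> is not suitable here: in a symmetric digraph every edge yields a
  \<^const>\<open>pre_digraph.cycle\<close> of length 2.
\<close>

definition undirected_tree :: "'a pair_pre_digraph \<Rightarrow> bool" where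
  "undirected_tree Q \<longleftrightarrow>
    pair_graph Q \<and> Digraph_Component.connected (with_proj Q) \<and>
    \<not> (\<exists>p. pre_digraph.cycle (with_proj Q) p \<and> 3 \<le> length p)"

definition rooted_iso ::
  "'b pair_pre_digraph \<Rightarrow> 'b \<Rightarrow> 'a pair_pre_digraph \<Rightarrow> 'a \<Rightarrow> bool" where
  "rooted_iso Q r T v \<longleftrightarrow>
    (\<exists>f. bij_betw f (pverts Q) (pverts T) \<and> f r = v \<and> parcs T = map_prod f f ` parcs Q)"

text \<open>
  \<open>G\<close> has head \<open>H\<close>, and its supertail consists of the \<open>s\<close> copies \<open>T 0, \<dots>, T (s - 1)\<close> of the tree
  \<open>Q\<close>, the root \<open>r\<close> of \<open>Q\<close> being placed at the vertex \<open>v\<close> of \<open>H\<close> in every copy.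
\<close>

definition superkite ::
  "'a pair_pre_digraph \<Rightarrow> 'a pair_pre_digraph \<Rightarrow> 'a \<Rightarrow> 'b pair_pre_digraph \<Rightarrow> 'b \<Rightarrow> nat \<Rightarrow> bool" where
  "superkite G H v Q r s \<longleftrightarrow>
    pair_graph H \<and> v \<in> pverts H \<and> undirected_tree Q \<and> r \<in> pverts Q \<and> 2 \<le> s \<and>
    (\<exists>T :: nat \<Rightarrow> 'a pair_pre_digraph.
      (\<forall>i<s. rooted_iso Q r (T i) v) \<and>
      (\<forall>i<s. pverts (T i) \<inter> pverts H = {v}) \<and>
      (\<forall>i<s. \<forall>j<s. i \<noteq> j \<longrightarrow> pverts (T i) \<inter> pverts (T j) = {v}) \<and>
      pverts G = pverts H \<union> (\<Union>i<s. pverts (T i)) \<and>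
      parcs G = parcs H \<union> (\<Union>i<s. parcs (T i)))"

end

theory Submission
  imports Defs "Jordan_Normal_Form.Schur_Decomposition" "HOL-Combinatorics.Permutations"
begin

text \<open>
  Let \<open>\<mu>\<close> be the smallest eigenvalue of the Laplacian of \<open>Q\<close> grounded at its root. Every function
  on \<open>G'\<close> that vanishes at \<open>v\<close> splits into functions on the head and on the tails, so the Laplacian
  of \<open>G'\<close> grounded at \<open>v\<close> has smallest eigenvalue at least \<open>\<mu>\<close>; a ground state placed with opposite
  signs on two of the tails shows that both algebraic connectivities are at most \<open>\<mu>\<close>.

  It remains to bound the spectral gap of \<open>F_k(G')\<close> below by \<open>\<mu>\<close>, and this holds for any graph and
  any vertex \<open>v\<close>: the gap of the token graph is at least the smallest eigenvalue of the Laplacian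
  grounded at \<open>v\<close>. For \<open>t < \<mu>\<close> there is a function \<open>\<phi>\<close> with \<open>\<phi> v = 0\<close>, positive elsewhere and
  satisfying \<open>L \<phi> \<ge> t \<phi>\<close> away from \<open>v\<close>. Induct on the number of vertices. A mean-zero function on
  \<open>k\<close>-sets is orthogonally the sum of a lift \<open>A \<mapsto> \<Sum>a\<in>A. \<psi> a\<close>, controlled by the one-particle
  inequality, and a function \<open>w\<close> whose sum over the sets containing any given vertex is zero. For
  \<open>w\<close>, delete the vertex \<open>x\<close> at which \<open>\<phi>\<close> is largest: the restrictions of \<open>w\<close> to the sets
  containing and avoiding \<open>x\<close> have mean zero, and \<open>\<phi>\<close> still satisfies \<open>L \<phi> \<ge> t \<phi>\<close> on the rest.
\<close>

section \<open>Real symmetric matrices\<close>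

lemma scalar_prod_symmetric_mat:
  fixes A :: "'a :: comm_semiring_0 mat"
  assumes A: "A \<in> carrier_mat n n" "A\<^sup>T = A" and x: "x \<in> carrier_vec n" and y: "y \<in> carrier_vec n"
  shows "x \<bullet> (A *\<^sub>v y) = y \<bullet> (A *\<^sub>v x)"
proof -
  have "x \<bullet> (A *\<^sub>v y) = (A\<^sup>T *\<^sub>v x) \<bullet> y"
    using transpose_vec_mult_scalar[OF A(1) y x] by simp
  also have "\<dots> = y \<bullet> (A *\<^sub>v x)"
    using A x y by (simp add: comm_scalar_prod[of _ n])
  finally show ?thesis .
qed

lemma scalar_prod_self_eq_0_iff:
  fixes x :: "real vec"
  assumes "x \<in> carrier_vec n"
  shows "x \<bullet> x = 0 \<longleftrightarrow> x = 0\<^sub>v n"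
  using conjugate_square_eq_0_vec[OF assms] by simp

lemma scalar_prod_self_ge_0: "(x :: real vec) \<bullet> x \<ge> 0"
  unfolding scalar_prod_def by (auto intro: sum_nonneg)

text \<open>Over the complex numbers there is a root \<open>a\<close> with eigenvector
  \<open>z = x + iy\<close>. Symmetry of \<open>A\<close> makes
  \<open>x \<bullet> (A *\<^sub>v y)\<close> and \<open>y \<bullet> (A *\<^sub>v x)\<close> agree,
  which forces \<open>Im a = 0\<close>; whichever of \<open>x\<close>, \<open>y\<close> is nonzero
  is then a real eigenvector.\<close>

lemma symmetric_real_mat_has_eigenvalue:
  fixes A :: "real mat"
  assumes A: "A \<in> carrier_mat n n" and sym: "A\<^sup>T = A" and n: "n > 0"
  shows "\<exists>e. eigenvalue A e"
proof -
  let ?C = "map_mat complex_of_real A"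
  have C: "?C \<in> carrier_mat n n" using A by simp
  from char_poly_factorized[OF C] n obtain a as
    where "char_poly ?C = (\<Prod>a\<leftarrow>a # as. [:- a, 1:])"
    by (metis length_0_conv list.exhaust neq0_conv)
  then have "poly (char_poly ?C) a = 0" by simp
  then have "eigenvalue ?C a" using eigenvalue_root_char_poly[OF C] by simp
  then obtain z where z: "z \<in> carrier_vec n" "z \<noteq> 0\<^sub>v n" "?C *\<^sub>v z = a \<cdot>\<^sub>v z"
    unfolding eigenvalue_def eigenvector_def using C by auto
  define x where "x = map_vec Re z"
  define y where "y = map_vec Im z"
  have xy: "x \<in> carrier_vec n" "y \<in> carrier_vec n" using z by (auto simp: x_def y_def)
  have entry: "(\<Sum>j<n. complex_of_real (A $$ (i, j)) * z $ j) = a * z $ i" if "i < n" for i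
    using arg_cong[OF z(3), of "\<lambda>w. w $ i"] that A z(1)
    by (simp add: mult_mat_vec_def scalar_prod_def row_def lessThan_atLeast0)
  have Ax: "A *\<^sub>v x = Re a \<cdot>\<^sub>v x - Im a \<cdot>\<^sub>v y"
  proof (rule eq_vecI)
    fix i assume "i < dim_vec (Re a \<cdot>\<^sub>v x - Im a \<cdot>\<^sub>v y)"
    then have i: "i < n" using xy by simp
    have "(A *\<^sub>v x) $ i = (\<Sum>j<n. A $$ (i, j) * Re (z $ j))"
      using A z(1) i
      by (simp add: mult_mat_vec_def scalar_prod_def row_def lessThan_atLeast0 x_def)
    also have "\<dots> = Re (\<Sum>j<n. complex_of_real (A $$ (i, j)) * z $ j)" by simp
    also have "\<dots> = (Re a \<cdot>\<^sub>v x - Im a \<cdot>\<^sub>v y) $ i"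
      unfolding entry[OF i] using z(1) i by (simp add: x_def y_def)
    finally show "(A *\<^sub>v x) $ i = (Re a \<cdot>\<^sub>v x - Im a \<cdot>\<^sub>v y) $ i" .
  qed (use A xy in auto)
  have Ay: "A *\<^sub>v y = Re a \<cdot>\<^sub>v y + Im a \<cdot>\<^sub>v x"
  proof (rule eq_vecI)
    fix i assume "i < dim_vec (Re a \<cdot>\<^sub>v y + Im a \<cdot>\<^sub>v x)"
    then have i: "i < n" using xy by simp
    have "(A *\<^sub>v y) $ i = (\<Sum>j<n. A $$ (i, j) * Im (z $ j))"
      using A z(1) i
      by (simp add: mult_mat_vec_def scalar_prod_def row_def lessThan_atLeast0 y_def)
    also have "\<dots> = Im (\<Sum>j<n. complex_of_real (A $$ (i, j)) * z $ j)" by simp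
    also have "\<dots> = (Re a \<cdot>\<^sub>v y + Im a \<cdot>\<^sub>v x) $ i"
      unfolding entry[OF i] using z(1) i by (simp add: x_def y_def)
    finally show "(A *\<^sub>v y) $ i = (Re a \<cdot>\<^sub>v y + Im a \<cdot>\<^sub>v x) $ i" .
  qed (use A xy in auto)
  have "y \<bullet> (A *\<^sub>v x) = Re a * (y \<bullet> x) - Im a * (y \<bullet> y)"
    unfolding Ax using xy by (simp add: scalar_prod_minus_distrib[of _ n])
  moreover have "x \<bullet> (A *\<^sub>v y) = Re a * (x \<bullet> y) + Im a * (x \<bullet> x)"
    unfolding Ay using xy by (simp add: scalar_prod_add_distrib[of _ n])
  moreover have "x \<bullet> y = y \<bullet> x" using xy by (simp add: comm_scalar_prod)
  ultimately have "Im a * (x \<bullet> x + y \<bullet> y) = 0"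
    using scalar_prod_symmetric_mat[OF A sym xy] by (simp add: algebra_simps)
  moreover have nz: "x \<noteq> 0\<^sub>v n \<or> y \<noteq> 0\<^sub>v n"
  proof (rule ccontr)
    assume *: "\<not> ?thesis"
    have "z $ i = 0" if "i < n" for i
    proof -
      have "x $ i = 0" "y $ i = 0" using * that by auto
      then show ?thesis using that z(1) by (simp add: x_def y_def complex_eq_iff)
    qed
    then have "z = 0\<^sub>v n" using z(1) by (intro eq_vecI) auto
    with z(2) show False by simp
  qed
  then have "x \<bullet> x + y \<bullet> y \<noteq> 0"
    using scalar_prod_self_eq_0_iff[OF xy(1)] scalar_prod_self_eq_0_iff[OF xy(2)]
      scalar_prod_self_ge_0[of x] scalar_prod_self_ge_0[of y] by linarith
  ultimately have "Im a = 0" by simp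
  then have "A *\<^sub>v x = Re a \<cdot>\<^sub>v x" "A *\<^sub>v y = Re a \<cdot>\<^sub>v y"
    using Ax Ay xy by (auto intro!: eq_vecI)
  then show ?thesis
    using nz xy A unfolding eigenvalue_def eigenvector_def by (metis carrier_matD(1))
qed

text \<open>\<open>v\<close> heads a basis, and Gram-Schmidt leaves the first vector in place, so
  normalising the result only rescales it. The factor \<open>c\<close> stays unspecified because
  only the direction of the first column matters.\<close>

lemma orthogonal_mat_with_first_col:
  fixes v :: "real vec"
  assumes v: "v \<in> carrier_vec n" "v \<noteq> 0\<^sub>v n"
  obtains W c where "W \<in> carrier_mat n n" "W\<^sup>T * W = 1\<^sub>m n" "col W 0 = c \<cdot>\<^sub>v v"
proof -
  interpret cof_vec_space n "TYPE(real)" .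
  define b where "b = basis_completion v"
  define ws where "ws = gram_schmidt n b"
  note b = basis_completion[OF v, folded b_def]
  have n: "n > 0" using v by (cases n) auto
  with b(6,7) obtain vs where bv: "b = v # vs" by (cases b) auto
  from gram_schmidt_result[OF b(2,4,5) refl, folded ws_def]
  have ws: "set ws \<subseteq> carrier_vec n" "corthogonal ws" "length ws = n" by (auto simp: b(6))
  from gram_schmidt_hd[OF v(1), of vs, folded bv] have hd: "hd ws = v" unfolding ws_def .
  define nw where "nw w = (1 / sqrt (w \<bullet> w)) \<cdot>\<^sub>v w" for w :: "real vec"
  define W where "W = mat_of_cols n (map nw ws)"
  have W: "W \<in> carrier_mat n n" unfolding W_def using ws(3) by auto
  have wc: "ws ! i \<in> carrier_vec n" if "i < n" for i using that ws by auto
  have colW: "col W i = nw (ws ! i)" if "i < n" for i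
    unfolding W_def using that ws(3) wc[OF that] by (subst col_mat_of_cols) (auto simp: nw_def)
  have "W\<^sup>T * W = 1\<^sub>m n"
  proof (rule eq_matI)
    fix i j assume "i < dim_row (1\<^sub>m n :: real mat)" "j < dim_col (1\<^sub>m n :: real mat)"
    then have ij: "i < n" "j < n" by auto
    have "(W\<^sup>T * W) $$ (i, j) = nw (ws ! i) \<bullet> nw (ws ! j)"
      using ij W colW by simp
    also have "\<dots> = (1 / sqrt (ws!i \<bullet> ws!i)) * (1 / sqrt (ws!j \<bullet> ws!j)) * (ws ! i \<bullet> ws ! j)"
      unfolding nw_def using wc[OF ij(1)] wc[OF ij(2)] by simp
    also have "\<dots> = (1\<^sub>m n) $$ (i, j)"
    proof (cases "i = j")
      case True
      have "ws ! i \<bullet> ws ! i \<noteq> 0"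
        using corthogonalD[OF ws(2), of i i] ij ws(3) by simp
      then show ?thesis using True ij scalar_prod_self_ge_0[of "ws ! i"] by simp
    next
      case False
      then have "ws ! i \<bullet> ws ! j = 0"
        using corthogonalD[OF ws(2), of i j] ij ws(3) by simp
      then show ?thesis using False ij by simp
    qed
    finally show "(W\<^sup>T * W) $$ (i, j) = (1\<^sub>m n) $$ (i, j)" .
  qed (use W in auto)
  moreover have "col W 0 = (1 / sqrt (v \<bullet> v)) \<cdot>\<^sub>v v"
    using colW[OF n] hd ws(3) n by (simp add: nw_def hd_conv_nth[symmetric] flip: length_greater_0_conv)
  ultimately show ?thesis using that W by blast
qed

text \<open>Deflation: an orthogonal \<open>W\<close> whose first column is an eigenvector turns
  \<open>A\<close> into a block matrix with one eigenvalue in the corner and a smaller symmetric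
  block, to which the induction hypothesis applies.\<close>

theorem symmetric_real_mat_diagonalizable:
  fixes A :: "real mat"
  assumes "A \<in> carrier_mat n n" "A\<^sup>T = A"
  shows "\<exists>P d. P \<in> carrier_mat n n \<and> P\<^sup>T * P = 1\<^sub>m n \<and> P\<^sup>T * A * P = mat_diag n d"
  using assms
proof (induction n arbitrary: A)
  case 0
  then show ?case by (intro exI[of _ "1\<^sub>m 0"] exI[of _ undefined]) (auto simp: mat_diag_def)
next
  case (Suc n)
  let ?N = "Suc n"
  note A = Suc.prems(1) and sym = Suc.prems(2)
  from symmetric_real_mat_has_eigenvalue[OF A sym] obtain e v
    where v: "v \<in> carrier_vec ?N" "v \<noteq> 0\<^sub>v ?N" "A *\<^sub>v v = e \<cdot>\<^sub>v v"
    unfolding eigenvalue_def eigenvector_def using A by auto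
  from orthogonal_mat_with_first_col[OF v(1,2)] obtain W c
    where W: "W \<in> carrier_mat ?N ?N" and WW: "W\<^sup>T * W = 1\<^sub>m ?N" and W0: "col W 0 = c \<cdot>\<^sub>v v" .
  define B where "B = W\<^sup>T * A * W"
  have B: "B \<in> carrier_mat ?N ?N" unfolding B_def using W A by auto
  have BT: "B\<^sup>T = B"
    unfolding B_def using W A sym
    by (simp add: transpose_mult[of _ ?N ?N _ ?N] assoc_mult_mat[of _ ?N ?N _ ?N _ ?N])
  have Bi0: "B $$ (i, 0) = (if i = 0 then e else 0)" if i: "i < ?N" for i
  proof -
    have "B $$ (i, 0) = col W i \<bullet> (A *\<^sub>v col W 0)"
      unfolding B_def using W A i
      by (subst assoc_mult_mat[of _ ?N ?N _ ?N _ ?N]) (auto simp: mult_mat_vec_def)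
    also have "A *\<^sub>v col W 0 = e \<cdot>\<^sub>v col W 0"
      unfolding W0 using v A by (simp add: mult_mat_vec[of _ ?N ?N] smult_smult_assoc mult.commute)
    also have "col W i \<bullet> (e \<cdot>\<^sub>v col W 0) = e * (W\<^sup>T * W) $$ (i, 0)"
      using W i by simp
    finally show ?thesis using i unfolding WW by simp
  qed
  have B0i: "B $$ (0, i) = (if i = 0 then e else 0)" if "i < ?N" for i
    using Bi0[OF that] arg_cong[OF BT, of "\<lambda>M. M $$ (i, 0)"] B that by simp
  define C where "C = mat n n (\<lambda>(i, j). B $$ (Suc i, Suc j))"
  have C: "C \<in> carrier_mat n n" unfolding C_def by simp
  have CT: "C\<^sup>T = C"
  proof (rule eq_matI)
    fix i j assume "i < dim_row C" "j < dim_col C"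
    then have ij: "i < n" "j < n" by (auto simp: C_def)
    then show "C\<^sup>T $$ (i, j) = C $$ (i, j)"
      using arg_cong[OF BT, of "\<lambda>M. M $$ (Suc i, Suc j)"] B by (simp add: C_def)
  qed (auto simp: C_def)
  from Suc.IH[OF C CT] obtain R d
    where R: "R \<in> carrier_mat n n" "R\<^sup>T * R = 1\<^sub>m n" "R\<^sup>T * C * R = mat_diag n d" by blast
  let ?E = "mat 1 1 (\<lambda>_. e)"
  let ?Z = "0\<^sub>m 1 n" and ?Z' = "0\<^sub>m n 1"
  have Bblock: "B = four_block_mat ?E ?Z ?Z' C"
  proof (rule eq_matI)
    fix i j assume "i < dim_row (four_block_mat ?E ?Z ?Z' C)" "j < dim_col (four_block_mat ?E ?Z ?Z' C)"
    then have "i < ?N" "j < ?N" using C by auto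
    then show "B $$ (i, j) = four_block_mat ?E ?Z ?Z' C $$ (i, j)"
      using Bi0 B0i C by (cases i; cases j) (auto simp: C_def)
  qed (use B C in auto)
  define R' where "R' = four_block_mat (1\<^sub>m 1) ?Z ?Z' R"
  have R': "R' \<in> carrier_mat ?N ?N" unfolding R'_def using four_block_carrier_mat[of "1\<^sub>m 1" 1 1 R n n] R by simp
  have R'T: "R'\<^sup>T = four_block_mat (1\<^sub>m 1) ?Z ?Z' R\<^sup>T"
    unfolding R'_def using R by (subst transpose_four_block_mat[of _ 1 1 _ n _ n]) auto
  have RR: "R'\<^sup>T * R' = 1\<^sub>m ?N"
    unfolding R'T unfolding R'_def using R
    by (subst mult_four_block_mat[of _ 1 1 _ n _ n _ _ 1 _ n]) auto
  have RBR: "R'\<^sup>T * B * R' = mat_diag ?N (\<lambda>i. case i of 0 \<Rightarrow> e | Suc j \<Rightarrow> d j)"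
  proof -
    have "R'\<^sup>T * B = four_block_mat ?E ?Z ?Z' (R\<^sup>T * C)"
      unfolding R'T Bblock using R C
      by (subst mult_four_block_mat[of _ 1 1 _ n _ n _ _ 1 _ n]) auto
    then have "R'\<^sup>T * B * R' = four_block_mat ?E ?Z ?Z' (mat_diag n d)"
      unfolding R'_def using R C
      by (simp, subst mult_four_block_mat[of _ 1 1 _ n _ n _ _ 1 _ n]) auto
    also have "\<dots> = mat_diag ?N (\<lambda>i. case i of 0 \<Rightarrow> e | Suc j \<Rightarrow> d j)"
    proof (rule eq_matI)
      fix i j
      assume "i < dim_row (mat_diag ?N (\<lambda>i. case i of 0 \<Rightarrow> e | Suc j \<Rightarrow> d j))"
        and "j < dim_col (mat_diag ?N (\<lambda>i. case i of 0 \<Rightarrow> e | Suc j \<Rightarrow> d j))"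
      then have "i < ?N" "j < ?N" by (auto simp: mat_diag_def)
      then show "four_block_mat ?E ?Z ?Z' (mat_diag n d) $$ (i, j)
          = mat_diag ?N (\<lambda>i. case i of 0 \<Rightarrow> e | Suc j \<Rightarrow> d j) $$ (i, j)"
        by (cases i; cases j) (auto simp: mat_diag_def)
    qed (auto simp: mat_diag_def)
    finally show ?thesis .
  qed
  show ?case
  proof (intro exI conjI)
    show "W * R' \<in> carrier_mat ?N ?N" using W R' by auto
    have T: "(W * R')\<^sup>T = R'\<^sup>T * W\<^sup>T" using W R' by (simp add: transpose_mult[of _ ?N ?N])
    have "(W * R')\<^sup>T * (W * R') = R'\<^sup>T * (W\<^sup>T * W) * R'"
      unfolding T using W R' by (simp add: assoc_mult_mat[of _ ?N ?N _ ?N _ ?N])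
    also have "\<dots> = 1\<^sub>m ?N" unfolding WW using R' RR by simp
    finally show "(W * R')\<^sup>T * (W * R') = 1\<^sub>m ?N" .
    have "(W * R')\<^sup>T * A * (W * R') = R'\<^sup>T * B * R'"
      unfolding T B_def using W R' A by (simp add: assoc_mult_mat[of _ ?N ?N _ ?N _ ?N])
    then show "(W * R')\<^sup>T * A * (W * R') = mat_diag ?N (\<lambda>i. case i of 0 \<Rightarrow> e | Suc j \<Rightarrow> d j)"
      using RBR by simp
  qed
qed

text \<open>Orthogonality makes \<open>P\<close> a similarity, so the characteristic polynomial is
  that of the diagonal matrix. Equality of multisets keeps multiplicities, which
  \<open>eigenvalue_list\<close> needs.\<close>

lemma similar_mat_diag_proots:
  fixes A :: "real mat"
  assumes A: "A \<in> carrier_mat n n" and P: "P \<in> carrier_mat n n" "P\<^sup>T * P = 1\<^sub>m n"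
    and D: "P\<^sup>T * A * P = mat_diag n d"
  shows "proots (char_poly A) = mset (map d [0..<n])"
proof -
  have PP: "P * P\<^sup>T = 1\<^sub>m n"
    using mat_mult_left_right_inverse[of "P\<^sup>T" n P] P by simp
  have "similar_mat_wit (mat_diag n d) A P\<^sup>T P"
    by (rule similar_mat_witI[of _ _ n]) (use A P PP D in auto)
  then have "similar_mat (mat_diag n d) A"
    unfolding similar_mat_def by blast
  then have "char_poly A = char_poly (mat_diag n d)"
    by (simp add: char_poly_similar)
  also have "\<dots> = (\<Prod>a\<leftarrow>diag_mat (mat_diag n d). [:- a, 1:])"
    by (rule char_poly_upper_triangular[of _ n]) (auto simp: mat_diag_def)
  also have "diag_mat (mat_diag n d) = map d [0..<n]"
    by (auto simp: diag_mat_def mat_diag_def)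
  finally have *: "char_poly A = (\<Prod>a\<leftarrow>map d [0..<n]. [:- a, 1:])" .
  have "proots (\<Prod>a\<leftarrow>as. [:- a, 1:]) = mset as" for as :: "real list"
  proof (induction as)
    case (Cons a as)
    have "(\<Prod>a\<leftarrow>as. [:- a, 1:]) \<noteq> 0" by (simp only: prod_list_zero_iff) auto
    then have "proots ([:- a, 1:] * (\<Prod>a\<leftarrow>as. [:- a, 1:])) = add_mset a (mset as)"
      by (subst proots_mult) (simp_all add: Cons del: mult_pCons_left)
    then show ?case by simp
  qed simp
  then show ?thesis unfolding * .
qed

text \<open>The columns of a diagonalising matrix come in arbitrary order; a permutation sorts them
  to match \<open>eigenvalue_list\<close>. The last two properties are Parseval's identity and the
  expansion of the quadratic form in the eigenbasis.\<close>

theorem eigenvalue_list_orthonormal_eigenvectors: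
  fixes A :: "real mat"
  assumes A: "A \<in> carrier_mat n n" and sym: "A\<^sup>T = A"
  obtains q where "length (eigenvalue_list A) = n"
    "\<forall>i<n. q i \<in> carrier_vec n \<and> A *\<^sub>v q i = (eigenvalue_list A ! i) \<cdot>\<^sub>v q i"
    "\<forall>i<n. \<forall>j<n. q i \<bullet> q j = (if i = j then 1 else 0)"
    "\<forall>x\<in>carrier_vec n. x \<bullet> x = (\<Sum>i<n. (q i \<bullet> x)\<^sup>2)"
    "\<forall>x\<in>carrier_vec n. x \<bullet> (A *\<^sub>v x) = (\<Sum>i<n. eigenvalue_list A ! i * (q i \<bullet> x)\<^sup>2)"
proof -
  let ?es = "eigenvalue_list A"
  from symmetric_real_mat_diagonalizable[OF A sym] obtain P d
    where P: "P \<in> carrier_mat n n" "P\<^sup>T * P = 1\<^sub>m n" and D: "P\<^sup>T * A * P = mat_diag n d" by blast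
  have PP: "P * P\<^sup>T = 1\<^sub>m n"
    using mat_mult_left_right_inverse[of "P\<^sup>T" n P] P by simp
  have "mset ?es = mset (map d [0..<n])"
    unfolding eigenvalue_list_def using similar_mat_diag_proots[OF A P D] by simp
  then obtain p where p: "p permutes {..<n}" "permute_list p (map d [0..<n]) = ?es"
    using mset_eq_permutation by (metis diff_zero length_map length_upt)
  have es: "?es ! i = d (p i)" if "i < n" for i
    using p that permutes_in_image[OF p(1), of i] unfolding p(2)[symmetric] permute_list_def by simp
  have AP: "A * P = P * mat_diag n d"
  proof -
    have "A * P = (P * P\<^sup>T) * (A * P)" unfolding PP using A P by simp
    also have "\<dots> = P * (P\<^sup>T * A * P)" using A P by (simp add: assoc_mult_mat[of _ n n _ n _ n])
    finally show ?thesis unfolding D .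
  qed
  have Acol: "A *\<^sub>v col P i = d i \<cdot>\<^sub>v col P i" if i: "i < n" for i
  proof -
    have "A *\<^sub>v col P i = col (A * P) i" using col_mult2[OF A P(1) i] by simp
    also have "\<dots> = d i \<cdot>\<^sub>v col P i"
      unfolding AP mat_diag_mult_right[OF P(1)] using P i by (intro eq_vecI) auto
    finally show ?thesis .
  qed
  have orth: "col P i \<bullet> col P j = (if i = j then 1 else 0)" if "i < n" "j < n" for i j
    using arg_cong[OF P(2), of "\<lambda>M. M $$ (i, j)"] that P(1) by simp
  have nrm: "x \<bullet> x = (\<Sum>i<n. (col P i \<bullet> x)\<^sup>2)" if x: "x \<in> carrier_vec n" for x
  proof -
    have "x \<bullet> x = x \<bullet> (P *\<^sub>v (P\<^sup>T *\<^sub>v x))"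
      using x P PP by (metis assoc_mult_mat_vec one_mult_mat_vec transpose_carrier_mat)
    also have "\<dots> = (P\<^sup>T *\<^sub>v x) \<bullet> (P\<^sup>T *\<^sub>v x)"
      using transpose_vec_mult_scalar[OF P(1), of "P\<^sup>T *\<^sub>v x" x] x P by simp
    also have "\<dots> = (\<Sum>i<n. (col P i \<bullet> x)\<^sup>2)"
      using P x by (simp add: scalar_prod_def[of "P\<^sup>T *\<^sub>v x"] power2_eq_square lessThan_atLeast0)
    finally show ?thesis .
  qed
  have frm: "x \<bullet> (A *\<^sub>v x) = (\<Sum>i<n. d i * (col P i \<bullet> x)\<^sup>2)" if x: "x \<in> carrier_vec n" for x
  proof -
    have col: "col P i \<bullet> (A *\<^sub>v x) = d i * (col P i \<bullet> x)" if i: "i < n" for i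
    proof -
      have c: "col P i \<in> carrier_vec n" using P i by auto
      have "col P i \<bullet> (A *\<^sub>v x) = x \<bullet> (A *\<^sub>v col P i)"
        by (rule scalar_prod_symmetric_mat[OF A sym c x])
      then show ?thesis using Acol[OF i] c x by (simp add: comm_scalar_prod[of _ n])
    qed
    have "x \<bullet> (A *\<^sub>v x) = x \<bullet> (P *\<^sub>v (P\<^sup>T *\<^sub>v (A *\<^sub>v x)))"
      using x P PP A by (metis assoc_mult_mat_vec mult_mat_vec_carrier one_mult_mat_vec transpose_carrier_mat)
    also have "\<dots> = (P\<^sup>T *\<^sub>v x) \<bullet> (P\<^sup>T *\<^sub>v (A *\<^sub>v x))"
      using transpose_vec_mult_scalar[OF P(1), of "P\<^sup>T *\<^sub>v (A *\<^sub>v x)" x] x P A by simp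
    also have "\<dots> = (\<Sum>i<n. (col P i \<bullet> x) * (col P i \<bullet> (A *\<^sub>v x)))"
      using P x A by (simp add: scalar_prod_def[of "P\<^sup>T *\<^sub>v x"] lessThan_atLeast0)
    also have "\<dots> = (\<Sum>i<n. d i * (col P i \<bullet> x)\<^sup>2)"
      using col by (intro sum.cong) (auto simp: power2_eq_square)
    finally show ?thesis .
  qed
  have perm: "(\<Sum>i<n. f (p i)) = (\<Sum>i<n. f i)" for f :: "nat \<Rightarrow> real"
    using sum.permute[OF p(1), of f] by (simp add: o_def)
  have pi: "p i < n" if "i < n" for i using permutes_in_image[OF p(1), of i] that by simp
  show thesis
  proof (rule that[of "\<lambda>i. col P (p i)"]; (intro allI impI ballI)?)
    show "length ?es = n" unfolding p(2)[symmetric] by simp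
  next
    fix i assume "i < n"
    then show "col P (p i) \<in> carrier_vec n \<and> A *\<^sub>v col P (p i) = (?es ! i) \<cdot>\<^sub>v col P (p i)"
      using Acol[OF pi] es P(1) by auto
  next
    fix i j assume ij: "i < n" "j < n"
    have "p i = p j \<longleftrightarrow> i = j" using permutes_inj[OF p(1)] by (auto dest: injD)
    then show "col P (p i) \<bullet> col P (p j) = (if i = j then 1 else 0)"
      using orth[OF pi pi] ij by simp
  next
    fix x :: "real vec" assume "x \<in> carrier_vec n"
    from nrm[OF this] show "x \<bullet> x = (\<Sum>i<n. (col P (p i) \<bullet> x)\<^sup>2)"
      by (simp add: perm[of "\<lambda>i. (col P i \<bullet> x)\<^sup>2"])
  next
    fix x :: "real vec" assume "x \<in> carrier_vec n"
    from frm[OF this] show "x \<bullet> (A *\<^sub>v x) = (\<Sum>i<n. ?es ! i * (col P (p i) \<bullet> x)\<^sup>2)"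
      by (simp add: es perm[of "\<lambda>i. d i * (col P i \<bullet> x)\<^sup>2"])
  qed
qed

section \<open>Variational characterisations of the two lowest eigenvalues\<close>

lemma min_eigenvalue_symmetric:
  fixes A :: "real mat"
  assumes A: "A \<in> carrier_mat n n" and sym: "A\<^sup>T = A" and n: "n > 0"
  shows "eigenvalue A (min_eigenvalue A)"
    and "x \<in> carrier_vec n \<Longrightarrow> min_eigenvalue A * (x \<bullet> x) \<le> x \<bullet> (A *\<^sub>v x)"
proof -
  let ?S = "{\<mu>. eigenvalue A \<mu>}"
  have "char_poly A \<noteq> 0" using degree_monic_char_poly[OF A] by auto
  then have fin: "finite ?S"
    using poly_roots_finite[of "char_poly A"] by (simp add: eigenvalue_root_char_poly[OF A])
  have "?S \<noteq> {}" using symmetric_real_mat_has_eigenvalue[OF A sym n] by auto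
  then show "eigenvalue A (min_eigenvalue A)"
    using Min_in[OF fin] unfolding min_eigenvalue_def by simp
  assume x: "x \<in> carrier_vec n"
  obtain q where "length (eigenvalue_list A) = n"
    and q: "\<forall>i<n. q i \<in> carrier_vec n \<and> A *\<^sub>v q i = (eigenvalue_list A ! i) \<cdot>\<^sub>v q i"
    "\<forall>i<n. \<forall>j<n. q i \<bullet> q j = (if i = j then 1 else 0)"
    "\<forall>x\<in>carrier_vec n. x \<bullet> x = (\<Sum>i<n. (q i \<bullet> x)\<^sup>2)"
    "\<forall>x\<in>carrier_vec n. x \<bullet> (A *\<^sub>v x) = (\<Sum>i<n. eigenvalue_list A ! i * (q i \<bullet> x)\<^sup>2)"
    using eigenvalue_list_orthonormal_eigenvectors[OF A sym] .
  have "min_eigenvalue A \<le> eigenvalue_list A ! i" if i: "i < n" for i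
  proof -
    have "q i \<noteq> 0\<^sub>v n" using q(2) i by force
    then have "eigenvalue A (eigenvalue_list A ! i)"
      using q(1) i A unfolding eigenvalue_def eigenvector_def by auto
    then show ?thesis unfolding min_eigenvalue_def using fin by simp
  qed
  then show "min_eigenvalue A * (x \<bullet> x) \<le> x \<bullet> (A *\<^sub>v x)"
    unfolding bspec[OF q(3) x] bspec[OF q(4) x] sum_distrib_left by (intro sum_mono mult_right_mono) auto
qed

text \<open>A Courant-Fischer argument by dimension count: a plane meets the orthogonal complement
  of any vector. For the upper bound the plane is spanned by \<open>e\<close> and \<open>u\<close>,
  for the lower bound by the first two eigenvectors. \<open>e\<close> is only known to lie in the
  kernel; it is not identified with \<open>q 0\<close>.\<close>

lemma second_eigenvalue_eq:
  fixes A :: "real mat"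
  assumes A: "A \<in> carrier_mat n n" and sym: "A\<^sup>T = A" and n: "n \<ge> 2"
    and e: "e \<in> carrier_vec n" "e \<noteq> 0\<^sub>v n" "A *\<^sub>v e = 0\<^sub>v n" and \<mu>: "\<mu> \<ge> 0"
    and lower: "\<And>x. x \<in> carrier_vec n \<Longrightarrow> x \<bullet> e = 0 \<Longrightarrow> \<mu> * (x \<bullet> x) \<le> x \<bullet> (A *\<^sub>v x)"
    and u: "u \<in> carrier_vec n" "u \<noteq> 0\<^sub>v n" "u \<bullet> e = 0" "u \<bullet> (A *\<^sub>v u) \<le> \<mu> * (u \<bullet> u)"
  shows "eigenvalue_list A ! 1 = \<mu>"
proof -
  let ?es = "eigenvalue_list A"
  obtain q where len: "length ?es = n"
    and q: "\<forall>i<n. q i \<in> carrier_vec n \<and> A *\<^sub>v q i = (?es ! i) \<cdot>\<^sub>v q i"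
    and orth: "\<forall>i<n. \<forall>j<n. q i \<bullet> q j = (if i = j then 1 else 0)"
    and nrm: "\<forall>x\<in>carrier_vec n. x \<bullet> x = (\<Sum>i<n. (q i \<bullet> x)\<^sup>2)"
    and frm: "\<forall>x\<in>carrier_vec n. x \<bullet> (A *\<^sub>v x) = (\<Sum>i<n. ?es ! i * (q i \<bullet> x)\<^sup>2)"
    using eigenvalue_list_orthonormal_eigenvectors[OF A sym] .
  have sorted: "sorted ?es" unfolding eigenvalue_list_def by simp
  then have mono: "?es ! i \<le> ?es ! j" if "i \<le> j" "j < n" for i j
    using that len by (simp add: sorted_iff_nth_mono)
  have q0: "q 0 \<in> carrier_vec n" and q1: "q 1 \<in> carrier_vec n" using q n by auto
  have above: "?es ! 1 * (y \<bullet> y) \<le> y \<bullet> (A *\<^sub>v y)" if y: "y \<in> carrier_vec n" "q 0 \<bullet> y = 0" for y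
    unfolding bspec[OF nrm y(1)] bspec[OF frm y(1)] sum_distrib_left
  proof (rule sum_mono)
    fix i assume "i \<in> {..<n}"
    then show "?es ! 1 * (q i \<bullet> y)\<^sup>2 \<le> ?es ! i * (q i \<bullet> y)\<^sup>2"
      using y mono[of 1 i] by (cases "i = 0") (auto intro: mult_right_mono)
  qed
  have pos: "x \<bullet> x > 0" if "x \<in> carrier_vec n" "x \<noteq> 0\<^sub>v n" for x :: "real vec"
    using that scalar_prod_self_eq_0_iff[of x n] scalar_prod_self_ge_0[of x] by simp
  have "?es ! 1 \<le> \<mu>"
  proof (rule ccontr)
    assume *: "\<not> ?thesis"
    let ?a = "q 0 \<bullet> u" and ?b = "q 0 \<bullet> e"
    \<comment> \<open>The combination of \<open>e\<close> and \<open>u\<close> that is orthogonal to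
      \<open>q 0\<close>.\<close>
    define y where "y = ?a \<cdot>\<^sub>v e - ?b \<cdot>\<^sub>v u"
    have y: "y \<in> carrier_vec n" unfolding y_def using e u by auto
    have "q 0 \<bullet> y = 0"
      unfolding y_def using e u q0 by (simp add: scalar_prod_minus_distrib[of _ n])
    note ab = above[OF y this]
    have eu: "e \<bullet> u = 0" using u e by (simp add: comm_scalar_prod[of _ n])
    have yy: "y \<bullet> y = ?a\<^sup>2 * (e \<bullet> e) + ?b\<^sup>2 * (u \<bullet> u)"
      unfolding y_def using e u eu
      by (simp add: scalar_prod_minus_distrib[of _ n] minus_scalar_prod_distrib[of _ n]
          power2_eq_square algebra_simps)
    have Ay: "A *\<^sub>v y = (- ?b) \<cdot>\<^sub>v (A *\<^sub>v u)"
    proof -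
      have "A *\<^sub>v y = ?a \<cdot>\<^sub>v (A *\<^sub>v e) - ?b \<cdot>\<^sub>v (A *\<^sub>v u)"
        unfolding y_def using A e u
        by (simp add: mult_minus_distrib_mat_vec[of _ n n] mult_mat_vec[of _ n n])
      then show ?thesis unfolding e(3) using A u by (intro eq_vecI) auto
    qed
    have "e \<bullet> (A *\<^sub>v u) = 0"
      using scalar_prod_symmetric_mat[OF A sym e(1) u(1)] e u by simp
    then have "y \<bullet> ((- ?b) \<cdot>\<^sub>v (A *\<^sub>v u)) = ?b\<^sup>2 * (u \<bullet> (A *\<^sub>v u))"
      unfolding y_def using e u A
      by (simp add: minus_scalar_prod_distrib[of _ n] power2_eq_square)
    then have "y \<bullet> (A *\<^sub>v y) = ?b\<^sup>2 * (u \<bullet> (A *\<^sub>v u))" by (simp only: Ay)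
    also have "\<dots> \<le> ?b\<^sup>2 * (\<mu> * (u \<bullet> u))"
      using u(4) by (intro mult_left_mono) auto
    also have "\<dots> \<le> \<mu> * (y \<bullet> y)"
      unfolding yy using \<mu> scalar_prod_self_ge_0[of e] by (simp add: algebra_simps)
    finally have "?es ! 1 * (y \<bullet> y) \<le> \<mu> * (y \<bullet> y)" using ab by linarith
    with * have "y \<bullet> y \<le> 0" by (simp add: mult_le_cancel_right)
    \<comment> \<open>Only \<open>y = 0\<close> escapes; then \<open>?a = 0\<close>, so
      \<open>u\<close> itself is orthogonal to \<open>q 0\<close> and contradicts its own Rayleigh
      quotient.\<close>
    then have "?a\<^sup>2 * (e \<bullet> e) \<le> 0"
      unfolding yy using scalar_prod_self_ge_0[of u] by (smt (verit) mult_nonneg_nonneg zero_le_power2)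
    then have "?a = 0" using pos[OF e(1,2)]
      by (simp add: mult_le_0_iff)
    from above[OF u(1) this] u(4) pos[OF u(1,2)] * show False
      by (smt (verit) mult_le_cancel_right)
  qed
  moreover have "\<mu> \<le> ?es ! 1"
  proof (rule ccontr)
    assume *: "\<not> ?thesis"
    let ?a = "q 1 \<bullet> e" and ?b = "q 0 \<bullet> e"
    have q00: "q 0 \<bullet> q 0 = 1" "q 1 \<bullet> q 1 = 1" "q 0 \<bullet> q 1 = 0" "q 1 \<bullet> q 0 = 0"
      using orth n by auto
    have Aq: "A *\<^sub>v q 0 = ?es ! 0 \<cdot>\<^sub>v q 0" "A *\<^sub>v q 1 = ?es ! 1 \<cdot>\<^sub>v q 1" using q n by auto
    have es01: "?es ! 0 \<le> ?es ! 1" using mono n by auto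
    \<comment> \<open>The combination of \<open>q 0\<close> and \<open>q 1\<close> that is
      orthogonal to \<open>e\<close>. If it vanishes, \<open>q 0\<close> is orthogonal to
      \<open>e\<close> and \<open>lower\<close> applies to \<open>q 0\<close> directly.\<close>
    define y where "y = ?a \<cdot>\<^sub>v q 0 - ?b \<cdot>\<^sub>v q 1"
    have y: "y \<in> carrier_vec n" unfolding y_def using q0 q1 by auto
    have ye: "y \<bullet> e = 0"
      unfolding y_def using e q0 q1 by (simp add: minus_scalar_prod_distrib[of _ n])
    have yy: "y \<bullet> y = ?a\<^sup>2 + ?b\<^sup>2"
      unfolding y_def using q0 q1 q00
      by (simp add: scalar_prod_minus_distrib[of _ n] minus_scalar_prod_distrib[of _ n]
          power2_eq_square algebra_simps)
    have "y \<bullet> (A *\<^sub>v y) = ?es ! 0 * ?a\<^sup>2 + ?es ! 1 * ?b\<^sup>2"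
    proof -
      have "A *\<^sub>v y = (?a * ?es ! 0) \<cdot>\<^sub>v q 0 - (?b * ?es ! 1) \<cdot>\<^sub>v q 1"
        unfolding y_def using A q0 q1 Aq
        by (simp add: mult_minus_distrib_mat_vec[of _ n n] mult_mat_vec[of _ n n] smult_smult_assoc)
      then show ?thesis
        unfolding y_def using q0 q1 q00
        by (simp add: scalar_prod_minus_distrib[of _ n] minus_scalar_prod_distrib[of _ n]
            power2_eq_square algebra_simps)
    qed
    also have "\<dots> \<le> ?es ! 1 * (y \<bullet> y)"
      unfolding yy using es01 by (simp add: algebra_simps mult_right_mono)
    finally have "\<mu> * (y \<bullet> y) \<le> ?es ! 1 * (y \<bullet> y)" using lower[OF y ye] by linarith
    with * have "y \<bullet> y \<le> 0" by (simp add: mult_le_cancel_right)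
    then have "?b = 0" unfolding yy by (smt (verit) zero_le_power2 zero_eq_power2)
    from lower[OF q0 this] have "\<mu> \<le> ?es ! 0" unfolding Aq using q0 q00 by simp
    then show False using es01 * by simp
  qed
  ultimately show ?thesis by simp
qed

section \<open>Quadratic forms of Laplacians\<close>

text \<open>Every undirected edge is counted twice, once for each of its arcs.\<close>

definition dirichlet_energy :: "('a \<times> 'a) set \<Rightarrow> ('a \<Rightarrow> real) \<Rightarrow> real" where
  "dirichlet_energy R u = (\<Sum>(a, b)\<in>R. (u a - u b)\<^sup>2)"

text \<open>Degrees are taken in all of \<open>G\<close>, so an edge leaving \<open>V\<close> still
  contributes the square of its inner value; this is what the energy of a function vanishing outside
  \<open>V\<close> records. The division by 2 undoes the double counting of edges.\<close>

lemma laplacian_quadratic_form: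
  assumes G: "pair_graph G" and V: "V \<subseteq> pverts G" and u: "\<And>a. a \<in> pverts G - V \<Longrightarrow> u a = 0"
  shows "(\<Sum>a\<in>V. u a * (\<Sum>b\<in>V. laplacian_entry G a b * u b)) = dirichlet_energy (parcs G) u / 2"
proof -
  interpret pair_graph G by fact
  let ?V = "pverts G" and ?R = "parcs G"
  have fin: "finite ?V" "finite ?R" by auto
  have finV: "finite V" using V fin finite_subset by blast
  have R: "?R \<subseteq> ?V \<times> ?V" using arc_fst_in_verts arc_snd_in_verts by fastforce
  have sym: "(b, a) \<in> ?R" if "(a, b) \<in> ?R" for a b
    using that arcs_symmetric by blast
  have deg: "real (out_degree (with_proj G) a) = (\<Sum>b\<in>?V. if (a, b) \<in> ?R then 1 else 0)" for a
  proof -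
    have "out_arcs (with_proj G) a = Pair a ` {b \<in> ?V. (a, b) \<in> ?R}"
      using R by (auto simp: out_arcs_def)
    then have "out_degree (with_proj G) a = card {b \<in> ?V. (a, b) \<in> ?R}"
      unfolding out_degree_def by (simp add: card_image inj_on_def)
    then show ?thesis using fin by (simp add: sum.If_cases Int_def)
  qed
  have arcs: "(\<Sum>(a, b)\<in>?R. f a b) = (\<Sum>a\<in>?V. \<Sum>b\<in>?V. if (a, b) \<in> ?R then f a b else 0)"
    for f :: "'a \<Rightarrow> 'a \<Rightarrow> real"
  proof -
    have "(\<Sum>(a, b)\<in>?R. f a b) = (\<Sum>(a, b)\<in>?V \<times> ?V. if (a, b) \<in> ?R then f a b else 0)"
      using R fin by (intro sum.mono_neutral_cong_left) auto
    then show ?thesis by (simp add: sum.cartesian_product)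
  qed
  have swap: "(\<Sum>(a, b)\<in>?R. f b) = (\<Sum>(a, b)\<in>?R. f a)" for f :: "'a \<Rightarrow> real"
    by (rule sum.reindex_bij_witness[of _ prod.swap prod.swap]) (auto dest: sym)
  have "dirichlet_energy ?R u
      = (\<Sum>(a, b)\<in>?R. (u a)\<^sup>2) + (\<Sum>(a, b)\<in>?R. (u b)\<^sup>2) - 2 * (\<Sum>(a, b)\<in>?R. u a * u b)"
    unfolding dirichlet_energy_def sum_distrib_left sum.distrib[symmetric] sum_subtractf[symmetric]
    by (rule sum.cong) (auto simp: power2_eq_square algebra_simps)
  then have "dirichlet_energy ?R u / 2 = (\<Sum>(a, b)\<in>?R. (u a)\<^sup>2) - (\<Sum>(a, b)\<in>?R. u a * u b)"
    using swap[of "\<lambda>a. (u a)\<^sup>2"] by simp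
  also have "\<dots> = (\<Sum>a\<in>?V. real (out_degree (with_proj G) a) * (u a)\<^sup>2
      - (\<Sum>b\<in>?V. if (a, b) \<in> ?R then u a * u b else 0))"
    unfolding arcs deg sum_distrib_right sum_subtractf
    by (intro arg_cong2[of _ _ _ _ "(-)"] sum.cong) auto
  also have "\<dots> = (\<Sum>a\<in>?V. u a * (\<Sum>b\<in>?V. laplacian_entry G a b * u b))"
  proof (rule sum.cong[OF refl])
    fix a assume a: "a \<in> ?V"
    have "(\<Sum>b\<in>?V. laplacian_entry G a b * u b)
        = (\<Sum>b\<in>?V. (if a = b then real (out_degree (with_proj G) a) * u a else 0))
          - (\<Sum>b\<in>?V. if (a, b) \<in> ?R then u b else 0)"
      unfolding sum_subtractf[symmetric]
      by (rule sum.cong) (auto simp: laplacian_entry_def algebra_simps)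
    also have "\<dots> = real (out_degree (with_proj G) a) * u a - (\<Sum>b\<in>?V. if (a, b) \<in> ?R then u b else 0)"
      using a fin by simp
    finally have *: "(\<Sum>b\<in>?V. laplacian_entry G a b * u b) = \<dots>" .
    have "(\<Sum>b\<in>?V. if (a, b) \<in> ?R then u a * u b else 0)
        = u a * (\<Sum>b\<in>?V. if (a, b) \<in> ?R then u b else 0)"
      unfolding sum_distrib_left by (rule sum.cong) auto
    then show "real (out_degree (with_proj G) a) * (u a)\<^sup>2
        - (\<Sum>b\<in>?V. if (a, b) \<in> ?R then u a * u b else 0)
      = u a * (\<Sum>b\<in>?V. laplacian_entry G a b * u b)"
      unfolding * by (simp add: power2_eq_square right_diff_distrib)
  qed
  also have "\<dots> = (\<Sum>a\<in>V. u a * (\<Sum>b\<in>?V. laplacian_entry G a b * u b))"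
    using V fin u by (intro sum.mono_neutral_right) auto
  also have "\<dots> = (\<Sum>a\<in>V. u a * (\<Sum>b\<in>V. laplacian_entry G a b * u b))"
    using V fin u by (intro sum.cong refl arg_cong2[of _ _ _ _ "(*)"] sum.mono_neutral_right) auto
  finally show ?thesis by simp
qed

lemma laplacian_entry_row_sum:
  assumes "pair_graph G" "a \<in> pverts G"
  shows "(\<Sum>b\<in>pverts G. laplacian_entry G a b) = 0"
proof -
  interpret pair_graph G by fact
  have "out_arcs (with_proj G) a = Pair a ` {b \<in> pverts G. (a, b) \<in> parcs G}"
    using arc_snd_in_verts by (fastforce simp: out_arcs_def)
  then have "out_degree (with_proj G) a = card {b \<in> pverts G. (a, b) \<in> parcs G}"
    unfolding out_degree_def by (simp add: card_image inj_on_def)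
  then show ?thesis
    using assms(2) by (simp add: laplacian_entry_def sum_subtractf sum.If_cases Int_def)
qed

text \<open>\<open>laplacian_on\<close> hides its vertex order behind \<open>SOME\<close>. One order
  is fixed here, and matrix-vector products, inner products and vectors are translated into
  functions on \<open>V\<close>.\<close>

lemma laplacian_on_enum:
  fixes G :: "'a pair_pre_digraph"
  assumes G: "pair_graph G" and V: "finite V"
  obtains xs where "distinct xs" "set xs = V" "length xs = card V"
    "laplacian_on V G \<in> carrier_mat (card V) (card V)" "(laplacian_on V G)\<^sup>T = laplacian_on V G"
    "\<forall>u. laplacian_on V G *\<^sub>v vec (card V) (\<lambda>i. u (xs ! i))
      = vec (card V) (\<lambda>i. \<Sum>b\<in>V. laplacian_entry G (xs ! i) b * u b)"
    "\<forall>f g :: 'a \<Rightarrow> real. vec (card V) (\<lambda>i. f (xs ! i)) \<bullet> vec (card V) (\<lambda>i. g (xs ! i)) = (\<Sum>a\<in>V. f a * g a)"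
    "\<forall>x :: real vec. x \<in> carrier_vec (card V) \<longrightarrow> (\<exists>u. x = vec (card V) (\<lambda>i. u (xs ! i)))"
proof -
  interpret pair_graph G by fact
  define xs where "xs = (SOME xs. distinct xs \<and> set xs = V)"
  have xs: "distinct xs" "set xs = V"
    using someI_ex[of "\<lambda>xs. distinct xs \<and> set xs = V"] finite_distinct_list[OF V]
    unfolding xs_def by blast+
  let ?n = "card V"
  have len: "length xs = ?n" using xs distinct_card by fastforce
  have M: "laplacian_on V G = mat ?n ?n (\<lambda>(i, j). laplacian_entry G (xs ! i) (xs ! j))"
    unfolding laplacian_on_def xs_def[symmetric] by simp
  have bij: "bij_betw ((!) xs) {0..<?n} V"
    by (rule bij_betw_nth[OF xs(1)]) (use xs len in auto)
  have sum: "(\<Sum>i\<in>{0..<?n}. f (xs ! i)) = (\<Sum>a\<in>V. f a)" for f :: "'a \<Rightarrow> real"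
    by (rule sum.reindex_bij_betw[OF bij])
  have sc: "vec ?n (\<lambda>i. f (xs ! i)) \<bullet> vec ?n (\<lambda>i. g (xs ! i)) = (\<Sum>a\<in>V. f a * g a)" for f g :: "'a \<Rightarrow> real"
    using sum[of "\<lambda>a. f a * g a"] by (simp add: scalar_prod_def)
  have row: "(laplacian_on V G *\<^sub>v vec ?n (\<lambda>i. u (xs ! i))) $ i
      = (\<Sum>b\<in>V. laplacian_entry G (xs ! i) b * u b)" if "i < ?n" for u i
    using that sum[of "\<lambda>b. laplacian_entry G (xs ! i) b * u b"]
    by (simp add: M mult_mat_vec_def scalar_prod_def row_def)
  have "(a, b) \<in> parcs G \<longleftrightarrow> (b, a) \<in> parcs G" for a b
    using arcs_symmetric by blast
  then have "laplacian_entry G a b = laplacian_entry G b a" for a b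
    unfolding laplacian_entry_def by simp
  then have symM: "(laplacian_on V G)\<^sup>T = laplacian_on V G"
    unfolding M by (intro eq_matI) auto
  have rows: "laplacian_on V G *\<^sub>v vec ?n (\<lambda>i. u (xs ! i))
      = vec ?n (\<lambda>i. \<Sum>b\<in>V. laplacian_entry G (xs ! i) b * u b)" for u
    using row by (intro eq_vecI) (auto simp: M)
  have "\<exists>u. x = vec ?n (\<lambda>i. u (xs ! i))" if x: "x \<in> carrier_vec ?n" for x :: "real vec"
  proof (intro exI eq_vecI)
    fix i assume "i < dim_vec (vec ?n (\<lambda>i. (\<lambda>a. x $ inv_into {0..<?n} ((!) xs) a) (xs ! i)))"
    then show "x $ i = vec ?n (\<lambda>i. (\<lambda>a. x $ inv_into {0..<?n} ((!) xs) a) (xs ! i)) $ i"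
      using bij by (simp add: bij_betw_def inv_into_f_f)
  qed (use x in simp)
  moreover have "laplacian_on V G \<in> carrier_mat ?n ?n" unfolding M by simp
  ultimately show ?thesis
    using that[OF xs len _ symM] rows sc by blast
qed

text \<open>The Rayleigh principle for a principal submatrix of the Laplacian, in terms of
  functions. The factor 2 matches the counting of both arcs of each edge in
  \<open>dirichlet_energy\<close>.\<close>

lemma min_eigenvalue_laplacian_on:
  fixes G :: "'a pair_pre_digraph"
  assumes G: "pair_graph G" and V: "V \<subseteq> pverts G" "V \<noteq> {}"
  shows "\<And>u. (\<And>a. a \<in> pverts G - V \<Longrightarrow> u a = 0) \<Longrightarrow>
      2 * min_eigenvalue (laplacian_on V G) * (\<Sum>a\<in>V. (u a)\<^sup>2) \<le> dirichlet_energy (parcs G) u"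
    and "\<exists>u. (\<forall>a. a \<notin> V \<longrightarrow> u a = 0) \<and> (\<Sum>a\<in>V. (u a)\<^sup>2) > 0 \<and>
      dirichlet_energy (parcs G) u = 2 * min_eigenvalue (laplacian_on V G) * (\<Sum>a\<in>V. (u a)\<^sup>2)"
proof -
  interpret pair_graph G by fact
  let ?L = "laplacian_on V G" and ?n = "card V"
  let ?\<mu> = "min_eigenvalue ?L"
  have fin: "finite V" using finite_subset[OF V(1)] by simp
  obtain xs where xs: "distinct xs" "set xs = V" "length xs = ?n"
    and L: "?L \<in> carrier_mat ?n ?n" "?L\<^sup>T = ?L"
    and row: "\<forall>u. ?L *\<^sub>v vec ?n (\<lambda>i. u (xs ! i))
      = vec ?n (\<lambda>i. \<Sum>b\<in>V. laplacian_entry G (xs ! i) b * u b)"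
    and sc: "\<forall>f g :: 'a \<Rightarrow> real. vec ?n (\<lambda>i. f (xs ! i)) \<bullet> vec ?n (\<lambda>i. g (xs ! i)) = (\<Sum>a\<in>V. f a * g a)"
    and ex: "\<forall>x :: real vec. x \<in> carrier_vec ?n \<longrightarrow> (\<exists>u. x = vec ?n (\<lambda>i. u (xs ! i)))"
    using laplacian_on_enum[OF G fin] .
  have n: "?n > 0" using V fin by (simp add: card_gt_0_iff)
  let ?vec = "\<lambda>u. vec ?n (\<lambda>i. u (xs ! i)) :: real vec"
  have frm: "?vec u \<bullet> (?L *\<^sub>v ?vec u) = dirichlet_energy (parcs G) u / 2"
    if "\<And>a. a \<in> pverts G - V \<Longrightarrow> u a = 0" for u
    using laplacian_quadratic_form[OF G V(1), of u] that
      sc[rule_format, of u "\<lambda>a. \<Sum>b\<in>V. laplacian_entry G a b * u b"] row by simp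
  have nrm: "?vec u \<bullet> ?vec u = (\<Sum>a\<in>V. (u a)\<^sup>2)" for u
    using sc by (simp add: power2_eq_square)
  show "2 * ?\<mu> * (\<Sum>a\<in>V. (u a)\<^sup>2) \<le> dirichlet_energy (parcs G) u"
    if "\<And>a. a \<in> pverts G - V \<Longrightarrow> u a = 0" for u
    using min_eigenvalue_symmetric(2)[OF L n, of "?vec u"] frm[of u] that nrm[of u] by simp
  from min_eigenvalue_symmetric(1)[OF L n] obtain x
    where x: "x \<in> carrier_vec ?n" "x \<noteq> 0\<^sub>v ?n" "?L *\<^sub>v x = ?\<mu> \<cdot>\<^sub>v x"
    unfolding eigenvalue_def eigenvector_def using L by auto
  from ex x(1) obtain w where w: "x = ?vec w" by auto
  \<comment> \<open>The values outside \<open>V\<close> are set to 0, as the quadratic form identity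
    requires.\<close>
  define u where "u a = (if a \<in> V then w a else 0)" for a
  have xu: "x = ?vec u"
    unfolding w u_def using xs nth_mem by (intro eq_vecI) auto
  have "x \<bullet> (?L *\<^sub>v x) = ?\<mu> * (x \<bullet> x)" unfolding x(3) using x(1) by simp
  then have "dirichlet_energy (parcs G) u = 2 * ?\<mu> * (\<Sum>a\<in>V. (u a)\<^sup>2)"
    using frm[of u] nrm[of u] unfolding xu by (simp add: u_def)
  moreover have "(\<Sum>a\<in>V. (u a)\<^sup>2) > 0"
    using scalar_prod_self_eq_0_iff[OF x(1)] scalar_prod_self_ge_0[of x] x(2) nrm[of u]
    unfolding xu[symmetric] by simp
  ultimately show "\<exists>u. (\<forall>a. a \<notin> V \<longrightarrow> u a = 0) \<and> (\<Sum>a\<in>V. (u a)\<^sup>2) > 0 \<and>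
      dirichlet_energy (parcs G) u = 2 * ?\<mu> * (\<Sum>a\<in>V. (u a)\<^sup>2)"
    by (intro exI[of _ u]) (auto simp: u_def)
qed

text \<open>The constants lie in the kernel of the Laplacian, so the second eigenvalue is governed
  by mean-zero functions: \<open>lower\<close> bounds their Rayleigh quotients and \<open>u\<close>
  attains the bound.\<close>

lemma algebraic_connectivity_eqI:
  fixes G :: "'a pair_pre_digraph"
  assumes G: "pair_graph G" and n: "2 \<le> card (pverts G)" and \<mu>: "\<mu> \<ge> 0"
    and lower: "\<And>f. (\<Sum>a\<in>pverts G. f a) = 0 \<Longrightarrow>
      2 * \<mu> * (\<Sum>a\<in>pverts G. (f a)\<^sup>2) \<le> dirichlet_energy (parcs G) f"
    and u: "(\<Sum>a\<in>pverts G. u a) = 0" "(\<Sum>a\<in>pverts G. (u a)\<^sup>2) \<noteq> 0"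
      "dirichlet_energy (parcs G) u \<le> 2 * \<mu> * (\<Sum>a\<in>pverts G. (u a)\<^sup>2)"
  shows "algebraic_connectivity G = \<mu>"
proof -
  interpret pair_graph G by fact
  let ?V = "pverts G"
  let ?L = "laplacian_on ?V G" and ?n = "card ?V"
  obtain xs where xs: "distinct xs" "set xs = ?V" "length xs = ?n"
    and L: "?L \<in> carrier_mat ?n ?n" "?L\<^sup>T = ?L"
    and row: "\<forall>u. ?L *\<^sub>v vec ?n (\<lambda>i. u (xs ! i))
      = vec ?n (\<lambda>i. \<Sum>b\<in>?V. laplacian_entry G (xs ! i) b * u b)"
    and sc: "\<forall>f g :: 'a \<Rightarrow> real. vec ?n (\<lambda>i. f (xs ! i)) \<bullet> vec ?n (\<lambda>i. g (xs ! i)) = (\<Sum>a\<in>?V. f a * g a)"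
    and ex: "\<forall>x :: real vec. x \<in> carrier_vec ?n \<longrightarrow> (\<exists>u. x = vec ?n (\<lambda>i. u (xs ! i)))"
    using laplacian_on_enum[OF G finite_verts] .
  let ?vec = "\<lambda>u. vec ?n (\<lambda>i. u (xs ! i)) :: real vec"
  have frm: "?vec u \<bullet> (?L *\<^sub>v ?vec u) = dirichlet_energy (parcs G) u / 2" for u
    using laplacian_quadratic_form[OF G subset_refl, of u]
      sc[rule_format, of u "\<lambda>a. \<Sum>b\<in>?V. laplacian_entry G a b * u b"] row by simp
  have nrm: "?vec u \<bullet> ?vec u = (\<Sum>a\<in>?V. (u a)\<^sup>2)" for u
    using sc by (simp add: power2_eq_square)
  define e where "e = ?vec (\<lambda>_. 1)"
  have e: "e \<in> carrier_vec ?n" unfolding e_def by simp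
  have "e $ 0 \<noteq> 0" unfolding e_def using n by simp
  then have e0: "e \<noteq> 0\<^sub>v ?n" using n by auto
  have Le: "?L *\<^sub>v e = 0\<^sub>v ?n"
  proof (rule eq_vecI)
    fix i assume "i < dim_vec (0\<^sub>v ?n :: real vec)"
    then have i: "i < ?n" by simp
    then have "xs ! i \<in> ?V" using xs nth_mem by metis
    then show "(?L *\<^sub>v e) $ i = 0\<^sub>v ?n $ i"
      unfolding e_def row[rule_format, of "\<lambda>_. 1"] using i laplacian_entry_row_sum[OF G] by simp
  qed (use L e in auto)
  have orth: "?vec f \<bullet> e = (\<Sum>a\<in>?V. f a)" for f
    unfolding e_def using sc[rule_format, of f "\<lambda>_. 1"] by simp
  have "eigenvalue_list ?L ! 1 = \<mu>"
  proof (rule second_eigenvalue_eq[OF L n e e0 Le \<mu>])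
    fix x :: "real vec" assume x: "x \<in> carrier_vec ?n" "x \<bullet> e = 0"
    from ex x(1) obtain f where f: "x = ?vec f" by auto
    show "\<mu> * (x \<bullet> x) \<le> x \<bullet> (?L *\<^sub>v x)"
      using lower[of f] x(2) orth[of f] frm[of f] nrm[of f] unfolding f by simp
  next
    show "?vec u \<in> carrier_vec ?n" by simp
    show "?vec u \<noteq> 0\<^sub>v ?n"
      using u(2) nrm[of u] scalar_prod_self_eq_0_iff[of "?vec u" ?n] by auto
    show "?vec u \<bullet> e = 0" using orth[of u] u(1) by simp
    show "?vec u \<bullet> (?L *\<^sub>v ?vec u) \<le> \<mu> * (?vec u \<bullet> ?vec u)"
      using frm[of u] nrm[of u] u(3) by simp
  qed
  then show ?thesis unfolding algebraic_connectivity_def laplacian_def .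
qed

section \<open>Energy of functions on token configurations\<close>

definition k_subsets :: "'a set \<Rightarrow> nat \<Rightarrow> 'a set set" where
  "k_subsets V k = {A. A \<subseteq> V \<and> card A = k}"

text \<open>The Dirichlet energy of the token graph, sorted by arcs of the underlying graph: the arc
  \<open>(a, b)\<close> moves a token from \<open>a\<close> to the free vertex \<open>b\<close>.
  This sorting makes the deletion of a vertex easy to follow.\<close>

definition token_energy :: "('a \<times> 'a) set \<Rightarrow> 'a set \<Rightarrow> nat \<Rightarrow> ('a set \<Rightarrow> real) \<Rightarrow> real" where
  "token_energy R V k f =
    (\<Sum>(a, b)\<in>R. \<Sum>A | A \<in> k_subsets V k \<and> a \<in> A \<and> b \<notin> A. (f A - f (insert b (A - {a})))\<^sup>2)"

lemma dirichlet_energy_nonneg: "0 \<le> dirichlet_energy R u"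
  unfolding dirichlet_energy_def by (auto intro: sum_nonneg)

lemma token_energy_nonneg: "0 \<le> token_energy R V k f"
  unfolding token_energy_def by (auto intro!: sum_nonneg)

lemma finite_k_subsets [simp]: "finite V \<Longrightarrow> finite (k_subsets V k)"
  unfolding k_subsets_def by auto

text \<open>Such a set is \<open>a\<close> together with \<open>k - 1\<close> further elements
  avoiding both vertices. The count is the constant by which lifting scales squared norms and
  energies; \<open>k = 0\<close> is excluded since \<open>k - 1\<close> would truncate to 0 and give
  1.\<close>

lemma card_k_subsets_separating:
  assumes V: "finite V" "a \<in> V" "b \<in> V" "a \<noteq> b" and k: "k \<ge> 1"
  shows "card {A. A \<in> k_subsets V k \<and> a \<in> A \<and> b \<notin> A} = (card V - 2) choose (k - 1)"
proof -
  have "bij_betw (insert a) {B. B \<subseteq> V - {a, b} \<and> card B = k - 1} {A. A \<in> k_subsets V k \<and> a \<in> A \<and> b \<notin> A}"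
  proof (rule bij_betw_byWitness[where f' = "\<lambda>A. A - {a}"])
    show "insert a ` {B. B \<subseteq> V - {a, b} \<and> card B = k - 1} \<subseteq> {A. A \<in> k_subsets V k \<and> a \<in> A \<and> b \<notin> A}"
    proof safe
      fix B assume B: "B \<subseteq> V - {a, b}" "card B = k - 1"
      then have "finite B" "a \<notin> B" using V(1) finite_subset[of B V] by auto
      then show "insert a B \<in> k_subsets V k" using B V k by (auto simp: k_subsets_def)
    qed (use V in auto)
    show "(\<lambda>A. A - {a}) ` {A. A \<in> k_subsets V k \<and> a \<in> A \<and> b \<notin> A} \<subseteq> {B. B \<subseteq> V - {a, b} \<and> card B = k - 1}"
      by (auto simp: k_subsets_def card_Diff_singleton)
  qed (auto simp: insert_absorb)
  from bij_betw_same_card[OF this, symmetric]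
  have "card {A. A \<in> k_subsets V k \<and> a \<in> A \<and> b \<notin> A} = card {B. B \<subseteq> V - {a, b} \<and> card B = k - 1}" .
  also have "\<dots> = card (V - {a, b}) choose (k - 1)"
    by (rule n_subsets) (use V in simp)
  also have "card (V - {a, b}) = card V - 2"
    using V by (subst card_Diff_subset) auto
  finally show ?thesis .
qed

lemma sum_k_subsets_swap:
  fixes g :: "'a set \<Rightarrow> real"
  assumes "finite V" "a \<in> V" "b \<in> V" "a \<noteq> b"
  shows "(\<Sum>A | A \<in> k_subsets V k \<and> a \<in> A \<and> b \<notin> A. g (insert b (A - {a})))
    = (\<Sum>A | A \<in> k_subsets V k \<and> b \<in> A \<and> a \<notin> A. g A)"
proof (rule sum.reindex_bij_witness[of _ "\<lambda>A. insert a (A - {b})" "\<lambda>A. insert b (A - {a})"])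
  have ks: "insert y (A - {x}) \<in> k_subsets V k"
    if "A \<in> k_subsets V k" "x \<in> A" "y \<notin> A" "y \<in> V" for x y A
  proof -
    have "finite A" using that(1) assms(1) finite_subset by (auto simp: k_subsets_def)
    moreover have "card A > 0" using \<open>finite A\<close> that(2) card_gt_0_iff by blast
    ultimately show ?thesis using that by (auto simp: k_subsets_def card_insert_if card_Diff_singleton)
  qed
  show "insert b (A - {a}) \<in> {A. A \<in> k_subsets V k \<and> b \<in> A \<and> a \<notin> A}"
    if "A \<in> {A. A \<in> k_subsets V k \<and> a \<in> A \<and> b \<notin> A}" for A
    using that ks[of A a b] assms by auto
  show "insert a (A - {b}) \<in> {A. A \<in> k_subsets V k \<and> a \<in> A \<and> b \<notin> A}"
    if "A \<in> {A. A \<in> k_subsets V k \<and> b \<in> A \<and> a \<notin> A}" for A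
    using that ks[of A b a] assms by auto
qed (use assms in auto)

text \<open>Interchanging the sums shows that the adjoint of lifting sends \<open>g\<close> to its
  sums over the sets through each vertex. Orthogonality to all lifts therefore means that these sums
  vanish.\<close>

lemma sum_lift_mult:
  fixes g :: "'a set \<Rightarrow> real"
  assumes "finite V"
  shows "(\<Sum>A\<in>k_subsets V k. (\<Sum>a\<in>A. \<psi> a) * g A) = (\<Sum>a\<in>V. \<psi> a * (\<Sum>A | A \<in> k_subsets V k \<and> a \<in> A. g A))"
proof -
  have "(\<Sum>A\<in>k_subsets V k. (\<Sum>a\<in>A. \<psi> a) * g A)
      = (\<Sum>A\<in>k_subsets V k. \<Sum>a\<in>V. if a \<in> A then \<psi> a * g A else 0)"
  proof (rule sum.cong[OF refl])
    fix A assume "A \<in> k_subsets V k"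
    then have "V \<inter> A = A" by (auto simp: k_subsets_def)
    then show "(\<Sum>a\<in>A. \<psi> a) * g A = (\<Sum>a\<in>V. if a \<in> A then \<psi> a * g A else 0)"
      using assms by (simp add: sum_distrib_right flip: sum.inter_restrict)
  qed
  also have "\<dots> = (\<Sum>a\<in>V. \<Sum>A\<in>k_subsets V k. if a \<in> A then \<psi> a * g A else 0)"
    by (rule sum.swap)
  also have "\<dots> = (\<Sum>a\<in>V. \<psi> a * (\<Sum>A | A \<in> k_subsets V k \<and> a \<in> A. g A))"
    using assms by (intro sum.cong refl) (simp add: sum_distrib_left flip: sum.inter_filter)
  finally show ?thesis .
qed

text \<open>On mean-zero functions, lifting followed by its adjoint is a scalar. Mean zero turns the
  sum over \<open>A\<close> into minus the sum over its complement, and each \<open>b\<close>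
  different from \<open>a\<close> lies outside the same number of sets through
  \<open>a\<close>.\<close>

lemma sum_lift_containing:
  fixes \<psi> :: "'a \<Rightarrow> real"
  assumes V: "finite V" "a \<in> V" and k: "k \<ge> 1" and \<psi>: "(\<Sum>b\<in>V. \<psi> b) = 0"
  shows "(\<Sum>A | A \<in> k_subsets V k \<and> a \<in> A. \<Sum>b\<in>A. \<psi> b) = real ((card V - 2) choose (k - 1)) * \<psi> a"
proof -
  let ?c = "real ((card V - 2) choose (k - 1))"
  have "(\<Sum>A | A \<in> k_subsets V k \<and> a \<in> A. \<Sum>b\<in>A. \<psi> b)
      = (\<Sum>A | A \<in> k_subsets V k \<and> a \<in> A. - (\<Sum>b\<in>V. if b \<notin> A then \<psi> b else 0))"
  proof (rule sum.cong[OF refl])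
    fix A assume "A \<in> {A. A \<in> k_subsets V k \<and> a \<in> A}"
    then have "A \<subseteq> V" by (auto simp: k_subsets_def)
    then have "(\<Sum>b\<in>V. \<psi> b) = (\<Sum>b\<in>V - A. \<psi> b) + (\<Sum>b\<in>A. \<psi> b)"
      using V by (simp add: sum.subset_diff)
    moreover have "(\<Sum>b\<in>V - A. \<psi> b) = (\<Sum>b\<in>V. if b \<notin> A then \<psi> b else 0)"
      using V by (simp add: set_diff_eq sum.inter_filter)
    ultimately show "(\<Sum>b\<in>A. \<psi> b) = - (\<Sum>b\<in>V. if b \<notin> A then \<psi> b else 0)" using \<psi> by simp
  qed
  also have "\<dots> = - (\<Sum>b\<in>V. \<Sum>A | A \<in> k_subsets V k \<and> a \<in> A. if b \<notin> A then \<psi> b else 0)"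
    by (simp add: sum_negf) (rule sum.swap)
  also have "\<dots> = - (\<Sum>b\<in>V. \<psi> b * real (card {A. A \<in> k_subsets V k \<and> a \<in> A \<and> b \<notin> A}))"
    using V by (simp add: conj_assoc mult.commute flip: sum.inter_filter)
  also have "(\<Sum>b\<in>V. \<psi> b * real (card {A. A \<in> k_subsets V k \<and> a \<in> A \<and> b \<notin> A})) = (\<Sum>b\<in>V - {a}. \<psi> b * ?c)"
    using V card_k_subsets_separating[OF V _ _ k]
    by (intro sum.mono_neutral_cong_right) auto
  also have "(\<Sum>b\<in>V - {a}. \<psi> b * ?c) = - (?c * \<psi> a)"
    using V \<psi> by (simp add: sum_diff1 flip: sum_distrib_right)
  finally show ?thesis by simp
qed

lemma sum_lift_squared:
  fixes \<psi> :: "'a \<Rightarrow> real"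
  assumes "finite V" "k \<ge> 1" "(\<Sum>b\<in>V. \<psi> b) = 0"
  shows "(\<Sum>A\<in>k_subsets V k. (\<Sum>a\<in>A. \<psi> a)\<^sup>2) = real ((card V - 2) choose (k - 1)) * (\<Sum>a\<in>V. (\<psi> a)\<^sup>2)"
  using sum_lift_mult[OF assms(1), of \<psi> "\<lambda>A. \<Sum>a\<in>A. \<psi> a" k] sum_lift_containing[OF assms(1) _ assms(2,3)]
  by (simp add: power2_eq_square sum_distrib_left mult.left_commute)

lemma sum_lift_zero:
  fixes \<psi> :: "'a \<Rightarrow> real"
  assumes V: "finite V" and k: "k \<ge> 1" and \<psi>: "(\<Sum>b\<in>V. \<psi> b) = 0"
  shows "(\<Sum>A\<in>k_subsets V k. \<Sum>a\<in>A. \<psi> a) = 0"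
proof -
  \<comment> \<open>The factor \<open>k\<close> is itself a lift, that of the constant 1, so the
    adjoint formula applies.\<close>
  have "real k * (\<Sum>A\<in>k_subsets V k. \<Sum>a\<in>A. \<psi> a) = (\<Sum>A\<in>k_subsets V k. (\<Sum>a\<in>A. 1) * (\<Sum>a\<in>A. \<psi> a))"
    unfolding sum_distrib_left by (rule sum.cong) (auto simp: k_subsets_def sum_distrib_left)
  also have "\<dots> = 0"
    unfolding sum_lift_mult[OF V] using sum_lift_containing[OF V _ k \<psi>] \<psi>
    by (simp flip: sum_distrib_left)
  finally show ?thesis using k by simp
qed

text \<open>The two parts do not interact: for every edge \<open>ab\<close>, the cross term is the difference of the
  sums of \<open>w\<close> over the sets containing \<open>a\<close> and over those containing \<open>b\<close>.\<close>

lemma token_energy_lift_add: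
  fixes \<psi> :: "'a \<Rightarrow> real"
  assumes V: "finite V" and R: "R \<subseteq> V \<times> V" and k: "k \<ge> 1"
    and w: "\<And>a. a \<in> V \<Longrightarrow> (\<Sum>A | A \<in> k_subsets V k \<and> a \<in> A. w A) = 0"
  shows "token_energy R V k (\<lambda>A. (\<Sum>a\<in>A. \<psi> a) + w A)
    = real ((card V - 2) choose (k - 1)) * dirichlet_energy R \<psi> + token_energy R V k w"
proof -
  let ?c = "real ((card V - 2) choose (k - 1))"
  let ?S = "\<lambda>a b. {A. A \<in> k_subsets V k \<and> a \<in> A \<and> b \<notin> A}"
  let ?f = "\<lambda>A. (\<Sum>a\<in>A. \<psi> a) + w A"
  have "(\<Sum>A\<in>?S a b. (?f A - ?f (insert b (A - {a})))\<^sup>2)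
      = ?c * (\<psi> a - \<psi> b)\<^sup>2 + (\<Sum>A\<in>?S a b. (w A - w (insert b (A - {a})))\<^sup>2)"
    if "(a, b) \<in> R" for a b
  proof (cases "a = b")
    case False
    have ab: "a \<in> V" "b \<in> V" using that R by auto
    \<comment> \<open>The sets containing both endpoints occur in both vertex sums and
      cancel.\<close>
    have split: "(\<Sum>A | A \<in> k_subsets V k \<and> x \<in> A. w A) = (\<Sum>A\<in>?S x y. w A)
        + (\<Sum>A | A \<in> k_subsets V k \<and> x \<in> A \<and> y \<in> A. w A)" for x y
      using V by (subst sum.union_disjoint[symmetric]) (auto intro!: sum.cong)
    have "(\<Sum>A\<in>?S a b. w A - w (insert b (A - {a}))) = (\<Sum>A\<in>?S a b. w A) - (\<Sum>A\<in>?S b a. w A)"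
      unfolding sum_subtractf sum_k_subsets_swap[OF V ab False] ..
    also have "\<dots> = 0"
      using split[of a b] split[of b a] w[OF ab(1)] w[OF ab(2)] by (simp add: conj_commute)
    finally have cross: "(\<Sum>A\<in>?S a b. w A - w (insert b (A - {a}))) = 0" .
    have diff: "?f A - ?f (insert b (A - {a})) = (\<psi> a - \<psi> b) + (w A - w (insert b (A - {a})))"
      if "A \<in> ?S a b" for A
    proof -
      have "finite A" using that V finite_subset by (auto simp: k_subsets_def)
      then show ?thesis using that by (simp add: sum_diff1)
    qed
    have "(\<Sum>A\<in>?S a b. (?f A - ?f (insert b (A - {a})))\<^sup>2)
        = (\<Sum>A\<in>?S a b. (\<psi> a - \<psi> b)\<^sup>2 + 2 * (\<psi> a - \<psi> b) * (w A - w (insert b (A - {a})))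
            + (w A - w (insert b (A - {a})))\<^sup>2)"
      by (rule sum.cong[OF refl], subst diff) (auto simp: power2_eq_square algebra_simps)
    also have "\<dots> = real (card (?S a b)) * (\<psi> a - \<psi> b)\<^sup>2
        + 2 * (\<psi> a - \<psi> b) * (\<Sum>A\<in>?S a b. w A - w (insert b (A - {a})))
        + (\<Sum>A\<in>?S a b. (w A - w (insert b (A - {a})))\<^sup>2)"
      by (simp only: sum.distrib sum_distrib_left sum_constant)
    finally show ?thesis
      unfolding cross card_k_subsets_separating[OF V ab False k] by simp
  qed simp
  then show ?thesis
    unfolding token_energy_def dirichlet_energy_def sum_distrib_left sum.distrib[symmetric]
    by (intro sum.cong) auto
qed

section \<open>Green's formula and the one-particle inequality\<close>

lemma green_formula:
  fixes u \<phi> :: "'a \<Rightarrow> real"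
  assumes V: "finite V" and R: "R \<subseteq> V \<times> V" "sym R"
  shows "(\<Sum>(a, b)\<in>R. (u a - u b) * (\<phi> a - \<phi> b)) = 2 * (\<Sum>a\<in>V. u a * (\<Sum>b\<in>R `` {a}. \<phi> a - \<phi> b))"
proof -
  have "(\<Sum>(a, b)\<in>R. u b * (\<phi> b - \<phi> a)) = (\<Sum>(a, b)\<in>R. u a * (\<phi> a - \<phi> b))"
    by (rule sum.reindex_bij_witness[of _ prod.swap prod.swap]) (use R(2) in \<open>auto dest: symD\<close>)
  moreover have "(\<Sum>(a, b)\<in>R. (u a - u b) * (\<phi> a - \<phi> b))
      = (\<Sum>(a, b)\<in>R. u a * (\<phi> a - \<phi> b)) + (\<Sum>(a, b)\<in>R. u b * (\<phi> b - \<phi> a))"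
    unfolding sum.distrib[symmetric] by (rule sum.cong) (auto simp: algebra_simps)
  moreover have "(\<Sum>(a, b)\<in>R. u a * (\<phi> a - \<phi> b)) = (\<Sum>a\<in>V. u a * (\<Sum>b\<in>R `` {a}. \<phi> a - \<phi> b))"
  proof -
    have "R = (SIGMA a:V. R `` {a})" using R by auto
    then have "(\<Sum>(a, b)\<in>R. u a * (\<phi> a - \<phi> b)) = (\<Sum>(a, b)\<in>(SIGMA a:V. R `` {a}). u a * (\<phi> a - \<phi> b))"
      by simp
    also have "\<dots> = (\<Sum>a\<in>V. \<Sum>b\<in>R `` {a}. u a * (\<phi> a - \<phi> b))"
      by (rule sum.Sigma[symmetric]) (use V R in \<open>auto intro: finite_subset[of _ V]\<close>)
    finally show ?thesis by (simp add: sum_distrib_left)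
  qed
  ultimately show ?thesis by simp
qed

text \<open>Picone's inequality, tested with the square of \<open>u\<close> divided by
  \<open>\<phi>\<close>. Green's formula moves the differences onto \<open>\<phi>\<close>, where the
  supersolution property produces the factor \<open>t\<close>.\<close>

lemma dirichlet_energy_ge_of_supersolution:
  assumes V: "finite V" and R: "R \<subseteq> V \<times> V" "sym R" and v: "v \<in> V" and t: "t \<ge> 0"
    and \<phi>: "\<phi> v = 0" "\<And>z. z \<in> V - {v} \<Longrightarrow> \<phi> z > 0"
      "\<And>z. z \<in> V - {v} \<Longrightarrow> t * \<phi> z \<le> (\<Sum>y\<in>R `` {z}. \<phi> z - \<phi> y)"
    and f: "(\<Sum>a\<in>V. f a) = 0"
  shows "2 * t * (\<Sum>a\<in>V. (f a)\<^sup>2) \<le> dirichlet_energy R f"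
proof -
  \<comment> \<open>Subtracting \<open>f v\<close> leaves the energy unchanged, makes the function
    vanish at \<open>v\<close> and, as \<open>f\<close> has mean zero, cannot decrease the sum of
    squares.\<close>
  define u where "u a = f a - f v" for a
  \<comment> \<open>At \<open>v\<close> this is \<open>0 / 0\<close>, which HOL evaluates to
    0.\<close>
  define \<rho> where "\<rho> a = (u a)\<^sup>2 / \<phi> a" for a
  have picone: "(\<rho> a - \<rho> b) * (\<phi> a - \<phi> b) \<le> (u a - u b)\<^sup>2" if "(a, b) \<in> R" for a b
  proof -
    have ab: "a \<in> V" "b \<in> V" using that R by auto
    show ?thesis
    proof (cases "a = v \<or> b = v")
      case True
      then show ?thesis
        using \<phi>(1) \<phi>(2)[of a] \<phi>(2)[of b] ab by (auto simp: \<rho>_def u_def power2_commute)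
    next
      case False
      then have pos: "\<phi> a > 0" "\<phi> b > 0" using \<phi> ab by auto
      \<comment> \<open>Away from \<open>v\<close> the deficit is a square over a positive number;
        edges at \<open>v\<close> give equality.\<close>
      have "(u a - u b)\<^sup>2 - (\<rho> a - \<rho> b) * (\<phi> a - \<phi> b) = (u a * \<phi> b - u b * \<phi> a)\<^sup>2 / (\<phi> a * \<phi> b)"
        unfolding \<rho>_def using pos by (simp add: field_simps power2_eq_square)
      then show ?thesis using pos by (smt (verit) divide_nonneg_pos mult_pos_pos zero_le_power2)
    qed
  qed
  have "0 \<le> real (card V) * (f v)\<^sup>2" by simp
  then have "(\<Sum>a\<in>V. (f a)\<^sup>2) \<le> (\<Sum>a\<in>V. (f a)\<^sup>2) - 2 * f v * (\<Sum>a\<in>V. f a) + real (card V) * (f v)\<^sup>2"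
    using f by simp
  also have "\<dots> = (\<Sum>a\<in>V. (f a)\<^sup>2 - 2 * f v * f a + (f v)\<^sup>2)"
    by (simp add: sum.distrib sum_subtractf sum_distrib_left)
  also have "\<dots> = (\<Sum>a\<in>V. (u a)\<^sup>2)"
    unfolding u_def by (rule sum.cong) (auto simp: power2_eq_square algebra_simps)
  finally have "2 * t * (\<Sum>a\<in>V. (f a)\<^sup>2) \<le> 2 * (\<Sum>a\<in>V. t * (u a)\<^sup>2)"
    using t by (simp add: mult_left_mono flip: sum_distrib_left)
  also have "(\<Sum>a\<in>V. t * (u a)\<^sup>2) \<le> (\<Sum>a\<in>V. \<rho> a * (\<Sum>b\<in>R `` {a}. \<phi> a - \<phi> b))"
  proof (rule sum_mono)
    fix a assume a: "a \<in> V"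
    show "t * (u a)\<^sup>2 \<le> \<rho> a * (\<Sum>b\<in>R `` {a}. \<phi> a - \<phi> b)"
    proof (cases "a = v")
      case False
      then have pos: "\<phi> a > 0" using \<phi> a by auto
      have "t * (u a)\<^sup>2 = \<rho> a * (t * \<phi> a)" using pos by (simp add: \<rho>_def)
      also have "\<dots> \<le> \<rho> a * (\<Sum>b\<in>R `` {a}. \<phi> a - \<phi> b)"
        using \<phi>(3)[of a] a False pos by (intro mult_left_mono) (auto simp: \<rho>_def)
      finally show ?thesis .
    qed (simp add: u_def \<rho>_def)
  qed
  also have "2 * (\<Sum>a\<in>V. \<rho> a * (\<Sum>b\<in>R `` {a}. \<phi> a - \<phi> b)) = (\<Sum>(a, b)\<in>R. (\<rho> a - \<rho> b) * (\<phi> a - \<phi> b))"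
    by (rule green_formula[OF V R, symmetric])
  also have "\<dots> \<le> (\<Sum>(a, b)\<in>R. (u a - u b)\<^sup>2)"
    using picone by (intro sum_mono) auto
  also have "\<dots> = dirichlet_energy R f"
    unfolding dirichlet_energy_def u_def by simp
  finally show ?thesis by simp
qed

section \<open>Deleting a vertex from the configurations\<close>

lemma k_subsets_trivial:
  assumes V: "finite V" and k: "k = 0 \<or> card V \<le> k"
  shows "\<exists>B. k_subsets V k \<subseteq> {B}"
proof (cases "k = 0")
  case True
  then have "A = {}" if "A \<in> k_subsets V k" for A
    using that finite_subset[OF _ V, of A] by (auto simp: k_subsets_def)
  then show ?thesis by blast
next
  case False
  then have "A = V" if "A \<in> k_subsets V k" for A
    using that k V card_seteq[of V A] by (auto simp: k_subsets_def)
  then show ?thesis by blast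
qed

lemma k_subsets_containing:
  assumes V: "finite V" "x \<in> V" and k: "k \<ge> 1"
  shows "bij_betw (insert x) (k_subsets (V - {x}) (k - 1)) {A. A \<in> k_subsets V k \<and> x \<in> A}"
proof (rule bij_betw_byWitness[where f' = "\<lambda>A. A - {x}"])
  show "insert x ` k_subsets (V - {x}) (k - 1) \<subseteq> {A. A \<in> k_subsets V k \<and> x \<in> A}"
  proof safe
    fix B assume B: "B \<in> k_subsets (V - {x}) (k - 1)"
    then have "finite B" "x \<notin> B" using V(1) finite_subset[of B V] by (auto simp: k_subsets_def)
    then show "insert x B \<in> k_subsets V k" using B V k by (auto simp: k_subsets_def)
  qed
qed (auto simp: k_subsets_def card_Diff_singleton insert_absorb)

text \<open>Configurations are sorted by whether they hold a token at \<open>x\<close>, which is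
  then frozen there. Moves along arcs avoiding \<open>x\<close> respect this splitting; moves
  through \<open>x\<close> are dropped, and only nonnegative terms are lost.\<close>

lemma token_energy_delete_vertex:
  assumes V: "finite V" "x \<in> V" and k: "k \<ge> 1" and R: "R \<subseteq> V \<times> V"
    and R': "R' = R \<inter> (V - {x}) \<times> (V - {x})"
  shows "token_energy R' (V - {x}) k w + token_energy R' (V - {x}) (k - 1) (\<lambda>B. w (insert x B))
    \<le> token_energy R V k w"
proof -
  let ?W = "V - {x}"
  let ?S = "\<lambda>V k a b. {A. A \<in> k_subsets V k \<and> a \<in> A \<and> b \<notin> A}"
  let ?D = "\<lambda>w a b A. (w A - w (insert b (A - {a})))\<^sup>2"
  have finR: "finite R" using R V finite_subset by blast
  have "(\<Sum>A\<in>?S ?W k a b. ?D w a b A) + (\<Sum>B\<in>?S ?W (k - 1) a b. ?D (\<lambda>B. w (insert x B)) a b B)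
      = (\<Sum>A\<in>?S V k a b. ?D w a b A)" if "(a, b) \<in> R'" for a b
  proof -
    have ab: "a \<noteq> x" "b \<noteq> x" using that R' by auto
    note bij = k_subsets_containing[OF V k]
    have "?S V k a b = ?S ?W k a b \<union> insert x ` ?S ?W (k - 1) a b"
    proof (intro equalityI subsetI)
      fix A assume A: "A \<in> ?S V k a b"
      show "A \<in> ?S ?W k a b \<union> insert x ` ?S ?W (k - 1) a b"
      proof (cases "x \<in> A")
        case True
        then have "A \<in> insert x ` k_subsets ?W (k - 1)"
          using A bij_betw_imp_surj_on[OF bij] by auto
        then show ?thesis using A ab by auto
      qed (use A in \<open>auto simp: k_subsets_def\<close>)
    next
      fix A assume "A \<in> ?S ?W k a b \<union> insert x ` ?S ?W (k - 1) a b"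
      then consider "A \<in> ?S ?W k a b" | B where "A = insert x B" "B \<in> ?S ?W (k - 1) a b" by blast
      then show "A \<in> ?S V k a b"
      proof cases
        case 1
        then show ?thesis by (auto simp: k_subsets_def)
      next
        case 2
        then show ?thesis using bij_betwE[OF bij] ab by auto
      qed
    qed
    moreover have "?S ?W k a b \<inter> insert x ` ?S ?W (k - 1) a b = {}"
      by (auto simp: k_subsets_def)
    moreover have "inj_on (insert x) (?S ?W (k - 1) a b)"
      using bij_betw_imp_inj_on[OF bij] by (rule inj_on_subset) auto
    ultimately have "(\<Sum>A\<in>?S V k a b. ?D w a b A)
        = (\<Sum>A\<in>?S ?W k a b. ?D w a b A) + (\<Sum>B\<in>?S ?W (k - 1) a b. ?D w a b (insert x B))"
      using V by (simp add: sum.union_disjoint sum.reindex)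
    moreover have "insert b (insert x B - {a}) = insert x (insert b (B - {a}))" for B
      using ab by auto
    ultimately show ?thesis by simp
  qed
  then have "token_energy R' ?W k w + token_energy R' ?W (k - 1) (\<lambda>B. w (insert x B))
      = (\<Sum>(a, b)\<in>R'. \<Sum>A\<in>?S V k a b. ?D w a b A)"
    unfolding token_energy_def sum.distrib[symmetric] by (intro sum.cong) auto
  also have "\<dots> \<le> token_energy R V k w"
    unfolding token_energy_def using finR R' by (intro sum_mono2) (auto intro: sum_nonneg)
  finally show ?thesis .
qed

text \<open>Removing the vertex where the supersolution is largest keeps it a supersolution, since every
  discarded difference is nonpositive.\<close>

theorem token_energy_ge_of_supersolution:
  fixes f :: "'a set \<Rightarrow> real"
  assumes "finite V" "R \<subseteq> V \<times> V" "sym R" "v \<in> V" "t \<ge> 0"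
    and "\<phi> v = 0" "\<And>z. z \<in> V - {v} \<Longrightarrow> \<phi> z > 0"
    and "\<And>z. z \<in> V - {v} \<Longrightarrow> t * \<phi> z \<le> (\<Sum>y\<in>R `` {z}. \<phi> z - \<phi> y)"
    and "(\<Sum>A\<in>k_subsets V k. f A) = 0"
  shows "2 * t * (\<Sum>A\<in>k_subsets V k. (f A)\<^sup>2) \<le> token_energy R V k f"
  using assms
proof (induction "card V" arbitrary: V R k f rule: less_induct)
  case less
  note V = less.prems(1) and R = less.prems(2,3) and v = less.prems(4) and t = less.prems(5)
    and \<phi> = less.prems(6-8) and f = less.prems(9)
  let ?K = "k_subsets V k"
  show ?case
  proof (cases "k = 0 \<or> card V \<le> k")
    case True
    from k_subsets_trivial[OF V this] obtain B where "?K \<subseteq> {B}" by blast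
    \<comment> \<open>With at most one configuration, mean zero forces \<open>f\<close> to vanish on
      it.\<close>
    then have "(\<Sum>A\<in>?K. (f A)\<^sup>2) = 0" using f by (auto simp: subset_singleton_iff)
    then show ?thesis using token_energy_nonneg by simp
  next
    case False
    then have k: "k \<ge> 1" "k < card V" by auto
    let ?c = "real ((card V - 2) choose (k - 1))"
    have c: "?c > 0" using k by simp
    \<comment> \<open>The lift of \<open>\<psi>\<close> is the orthogonal projection of
      \<open>f\<close> onto lifts: by \<open>sum_lift_containing\<close>, dividing by
      \<open>?c\<close> gives both the same sums over the sets through each vertex.\<close>
    define \<psi> where "\<psi> a = (\<Sum>A | A \<in> ?K \<and> a \<in> A. f A) / ?c" for a
    define w where "w A = f A - (\<Sum>a\<in>A. \<psi> a)" for A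
    have "(\<Sum>a\<in>V. 1 * (\<Sum>A | A \<in> ?K \<and> a \<in> A. f A)) = (\<Sum>A\<in>?K. (\<Sum>a\<in>A. 1) * f A)"
      by (rule sum_lift_mult[OF V, symmetric])
    also have "\<dots> = real k * (\<Sum>A\<in>?K. f A)"
      unfolding sum_distrib_left by (rule sum.cong) (auto simp: k_subsets_def)
    finally have \<psi>0: "(\<Sum>a\<in>V. \<psi> a) = 0"
      using f by (simp add: \<psi>_def flip: sum_divide_distrib)
    have w: "(\<Sum>A | A \<in> ?K \<and> a \<in> A. w A) = 0" if a: "a \<in> V" for a
      unfolding w_def sum_subtractf sum_lift_containing[OF V a k(1) \<psi>0] using c by (simp add: \<psi>_def)
    have w0: "(\<Sum>A\<in>?K. w A) = 0"
      unfolding w_def sum_subtractf using f sum_lift_zero[OF V k(1) \<psi>0] by simp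
    have cross: "(\<Sum>A\<in>?K. (\<Sum>a\<in>A. \<psi> a) * w A) = 0"
      using sum_lift_mult[OF V, of \<psi> w k] w by simp
    have "(\<Sum>A\<in>?K. (f A)\<^sup>2)
        = (\<Sum>A\<in>?K. (\<Sum>a\<in>A. \<psi> a)\<^sup>2 + 2 * ((\<Sum>a\<in>A. \<psi> a) * w A) + (w A)\<^sup>2)"
      by (rule sum.cong) (auto simp: w_def power2_eq_square algebra_simps)
    then have norm: "(\<Sum>A\<in>?K. (f A)\<^sup>2) = ?c * (\<Sum>a\<in>V. (\<psi> a)\<^sup>2) + (\<Sum>A\<in>?K. (w A)\<^sup>2)"
      using cross sum_lift_squared[OF V k(1) \<psi>0] by (simp add: sum.distrib flip: sum_distrib_left)
    have energy: "token_energy R V k f = ?c * dirichlet_energy R \<psi> + token_energy R V k w"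
    proof -
      have "(\<lambda>A. (\<Sum>a\<in>A. \<psi> a) + w A) = f" by (simp add: w_def fun_eq_iff)
      then show ?thesis using token_energy_lift_add[OF V R(1) k(1) w, of \<psi>] by simp
    qed
    have one: "2 * t * (\<Sum>a\<in>V. (\<psi> a)\<^sup>2) \<le> dirichlet_energy R \<psi>"
      by (rule dirichlet_energy_ge_of_supersolution[OF V R v t \<phi> \<psi>0])
    \<comment> \<open>The vertex to delete maximises \<open>\<phi>\<close> among those other than
      \<open>v\<close>, so \<open>v\<close> survives for the induction.\<close>
    have "V - {v} \<noteq> {}"
      using k card_mono[of "{v}" V] by auto
    then have "Max (\<phi> ` (V - {v})) \<in> \<phi> ` (V - {v})" using V by (intro Max_in) auto
    then obtain x where "x \<in> V - {v}" and "\<phi> x = Max (\<phi> ` (V - {v}))" by force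
    then have x: "x \<in> V - {v}" "\<And>y. y \<in> V - {v} \<Longrightarrow> \<phi> y \<le> \<phi> x"
      using V by auto
    let ?W = "V - {x}"
    define R' where "R' = R \<inter> ?W \<times> ?W"
    have xV: "x \<in> V" using x by simp
    have card: "card ?W < card V" using V xV by (rule card_Diff1_less)
    have super: "t * \<phi> z \<le> (\<Sum>y\<in>R' `` {z}. \<phi> z - \<phi> y)" if z: "z \<in> ?W - {v}" for z
    proof -
      have fin: "finite (R `` {z})" using R(1) V by (auto intro: finite_subset[of _ V])
      have "R' `` {z} = R `` {z} - {x}" unfolding R'_def using z R(1) by auto
      then have "(\<Sum>y\<in>R `` {z}. \<phi> z - \<phi> y)
          = (\<Sum>y\<in>R' `` {z}. \<phi> z - \<phi> y) + (if x \<in> R `` {z} then \<phi> z - \<phi> x else 0)"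
        using fin by (simp add: sum_diff1)
      then show ?thesis using \<phi>(3)[of z] x(2)[of z] z by (auto split: if_splits)
    qed
    \<comment> \<open>The number of tokens stays free: the bound is used for \<open>k\<close> tokens
      off \<open>x\<close> and for \<open>k - 1\<close> tokens besides one at
      \<open>x\<close>.\<close>
    have IH: "2 * t * (\<Sum>A\<in>k_subsets ?W j. (g A)\<^sup>2) \<le> token_energy R' ?W j g"
      if "(\<Sum>A\<in>k_subsets ?W j. g A) = 0" for j g
    proof (rule less.hyps[OF card _ _ _ _ t \<phi>(1) _ super that])
      show "sym R'" unfolding R'_def using R(2) by (auto simp: sym_def)
    qed (use V v x \<phi>(2) in \<open>auto simp: R'_def\<close>)
    have split: "(\<Sum>A\<in>?K. g A) = (\<Sum>A\<in>k_subsets ?W k. g A)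
        + (\<Sum>B\<in>k_subsets ?W (k - 1). g (insert x B))" for g :: "'a set \<Rightarrow> real"
    proof -
      have "?K = k_subsets ?W k \<union> {A. A \<in> ?K \<and> x \<in> A}" "k_subsets ?W k \<inter> {A. A \<in> ?K \<and> x \<in> A} = {}"
        by (auto simp: k_subsets_def)
      then have "(\<Sum>A\<in>?K. g A) = (\<Sum>A\<in>k_subsets ?W k. g A) + (\<Sum>A | A \<in> ?K \<and> x \<in> A. g A)"
        using V by (metis (no_types, lifting) finite_Un finite_k_subsets sum.union_disjoint)
      then show ?thesis
        using sum.reindex_bij_betw[OF k_subsets_containing[OF V xV k(1)], of g] by simp
    qed
    \<comment> \<open>Vanishing sums through every vertex, here \<open>x\<close>, give mean zero on
      one part; mean zero of \<open>w\<close> then gives it on the other. This is why the lift is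
      split off first.\<close>
    have with_x: "(\<Sum>B\<in>k_subsets ?W (k - 1). w (insert x B)) = 0"
      using sum.reindex_bij_betw[OF k_subsets_containing[OF V xV k(1)], of w] w[OF xV] by simp
    then have without_x: "(\<Sum>A\<in>k_subsets ?W k. w A) = 0" using split[of w] w0 by simp
    have "2 * t * (\<Sum>A\<in>?K. (w A)\<^sup>2) \<le> token_energy R V k w"
      using IH[OF without_x] IH[OF with_x] split[of "\<lambda>A. (w A)\<^sup>2"]
        token_energy_delete_vertex[OF V xV k(1) R(1) R'_def, of w]
      by (simp add: distrib_left)
    moreover have "?c * (2 * t * (\<Sum>a\<in>V. (\<psi> a)\<^sup>2)) \<le> ?c * dirichlet_energy R \<psi>"
      using one by (intro mult_left_mono) auto
    ultimately show ?thesis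
      unfolding norm energy by (simp add: distrib_left mult.left_commute)
  qed
qed

section \<open>Positive supersolutions below the grounded eigenvalue\<close>

lemma linear_system_solvable:
  fixes N :: "'a \<Rightarrow> 'a \<Rightarrow> 'b :: field"
  assumes W: "finite W"
    and inj: "\<And>u. (\<And>a. a \<in> W \<Longrightarrow> (\<Sum>b\<in>W. N a b * u b) = 0) \<Longrightarrow> \<forall>a\<in>W. u a = 0"
  shows "\<exists>\<phi>. \<forall>a\<in>W. (\<Sum>b\<in>W. N a b * \<phi> b) = g a"
proof -
  obtain xs where xs: "distinct xs" "set xs = W" using finite_distinct_list[OF W] by blast
  define n where "n = length xs"
  have bij: "bij_betw ((!) xs) {0..<n} W"
    by (rule bij_betw_nth[OF xs(1)]) (auto simp: n_def xs)
  define ix where "ix = inv_into {0..<n} ((!) xs)"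
  have ix: "ix (xs ! i) = i" if "i < n" for i
    using that bij unfolding ix_def bij_betw_def by (simp add: inv_into_f_f)
  have sum: "(\<Sum>i = 0..<n. h (xs ! i)) = (\<Sum>a\<in>W. h a)" for h :: "'a \<Rightarrow> 'b"
    by (rule sum.reindex_bij_betw[OF bij])
  define M where "M = mat n n (\<lambda>(i, j). N (xs ! i) (xs ! j))"
  have M: "M \<in> carrier_mat n n" unfolding M_def by simp
  have Mx: "(M *\<^sub>v x) $ i = (\<Sum>b\<in>W. N (xs ! i) b * x $ ix b)" if "x \<in> carrier_vec n" "i < n" for x i
  proof -
    have "(M *\<^sub>v x) $ i = (\<Sum>j = 0..<n. N (xs ! i) (xs ! j) * x $ j)"
      using that by (simp add: M_def mult_mat_vec_def scalar_prod_def row_def)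
    also have "\<dots> = (\<Sum>j = 0..<n. N (xs ! i) (xs ! j) * x $ ix (xs ! j))"
      using ix by (intro sum.cong) auto
    also have "\<dots> = (\<Sum>b\<in>W. N (xs ! i) b * x $ ix b)" by (rule sum)
    finally show ?thesis .
  qed
  have nth: "\<exists>i<n. a = xs ! i" if "a \<in> W" for a
    using that xs(2) by (auto simp: n_def in_set_conv_nth)
  have "det M \<noteq> 0"
  proof
    assume "det M = 0"
    then obtain x where x: "x \<in> carrier_vec n" "x \<noteq> 0\<^sub>v n" "M *\<^sub>v x = 0\<^sub>v n"
      using det_0_iff_vec_prod_zero_field[OF M] by auto
    have "(\<Sum>b\<in>W. N a b * x $ ix b) = 0" if "a \<in> W" for a
    proof -
      from nth[OF that] obtain i where "i < n" "a = xs ! i" by blast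
      then show ?thesis using Mx[OF x(1), of i] x(3) by simp
    qed
    from inj[OF this] have z: "\<forall>a\<in>W. x $ ix a = 0" .
    have "x $ i = 0" if "i < n" for i
      using z ix[OF that] that xs nth_mem unfolding n_def by metis
    then have "x = 0\<^sub>v n" using x(1) by (intro eq_vecI) auto
    with x(2) show False by simp
  qed
  from det_non_zero_imp_unit[OF M this, of "()"] obtain B
    where B: "B \<in> carrier_mat n n" "M * B = 1\<^sub>m n"
    unfolding Units_def by (auto simp: ring_mat_def)
  define y where "y = vec n (\<lambda>i. g (xs ! i))"
  have y: "y \<in> carrier_vec n" unfolding y_def by simp
  have "M *\<^sub>v (B *\<^sub>v y) = y"
    using assoc_mult_mat_vec[OF M B(1) y] B(2) y by simp
  then have "(\<Sum>b\<in>W. N (xs ! i) b * (B *\<^sub>v y) $ ix b) = g (xs ! i)" if "i < n" for i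
    using Mx[of "B *\<^sub>v y" i] B y that by (simp add: y_def)
  then show ?thesis
    using nth by (intro exI[of _ "\<lambda>b. (B *\<^sub>v y) $ ix b"]) auto
qed

text \<open>For \<open>t < \<mu>\<close> the grounded Laplacian minus \<open>t\<close> is positive
  definite, hence invertible, and \<open>\<phi>\<close> is its solution with right-hand side 1.
  Testing with the negative part gives \<open>\<phi> \<ge> 0\<close>. A ground state would not
  serve, as it can vanish on whole components once \<open>v\<close> is removed.\<close>

lemma supersolution_exists:
  assumes V: "finite V" "v \<in> V" and R: "R \<subseteq> V \<times> V" "sym R"
    and \<mu>: "\<And>u. u v = 0 \<Longrightarrow> 2 * \<mu> * (\<Sum>a\<in>V. (u a)\<^sup>2) \<le> dirichlet_energy R u"
    and t: "t < \<mu>"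
  obtains \<phi> where "\<phi> v = (0 :: real)" "\<forall>z\<in>V - {v}. \<phi> z > 0"
    "\<forall>z\<in>V - {v}. t * \<phi> z \<le> (\<Sum>y\<in>R `` {z}. \<phi> z - \<phi> y)"
proof -
  let ?W = "V - {v}"
  have fin: "finite (R `` {a})" for a using R(1) V by (auto intro: finite_subset[of _ V])
  \<comment> \<open>The entries of the grounded Laplacian shifted by \<open>t\<close>.\<close>
  define N where "N a b = (if a = b then real (card (R `` {a})) - t else 0) - (if (a, b) \<in> R then 1 else 0)"
    for a b
  have N: "(\<Sum>b\<in>?W. N a b * u b) = (\<Sum>y\<in>R `` {a}. u a - u y) - t * u a"
    if a: "a \<in> ?W" and u: "u v = 0" for a u
  proof -
    have "(\<Sum>b\<in>?W. N a b * u b) = (\<Sum>b\<in>?W. if a = b then (real (card (R `` {a})) - t) * u a else 0)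
        - (\<Sum>b\<in>?W. if (a, b) \<in> R then u b else 0)"
      unfolding sum_subtractf[symmetric] by (rule sum.cong) (auto simp: N_def algebra_simps)
    also have "(\<Sum>b\<in>?W. if a = b then (real (card (R `` {a})) - t) * u a else 0) = (real (card (R `` {a})) - t) * u a"
      using a V by simp
    also have "(\<Sum>b\<in>?W. if (a, b) \<in> R then u b else 0) = (\<Sum>b\<in>R `` {a}. u b)"
    proof -
      have "(\<Sum>b\<in>?W. if (a, b) \<in> R then u b else 0) = (\<Sum>b\<in>?W \<inter> R `` {a}. u b)"
        using V by (simp add: sum.inter_restrict)
      also have "\<dots> = (\<Sum>b\<in>R `` {a}. u b)"
        using fin R(1) u by (intro sum.mono_neutral_left) auto
      finally show ?thesis .
    qed
    finally show ?thesis by (simp add: sum_subtractf algebra_simps)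
  qed
  have form: "2 * (\<Sum>a\<in>V. u a * (\<Sum>y\<in>R `` {a}. u a - u y)) = dirichlet_energy R u" for u
    using green_formula[OF V(1) R, of u u] by (simp add: dirichlet_energy_def power2_eq_square)
  have zero: "\<forall>a\<in>V. u a = 0" if "(\<mu> - t) * (\<Sum>a\<in>V. (u a)\<^sup>2) \<le> 0" for u :: "'a \<Rightarrow> real"
  proof -
    have "(\<Sum>a\<in>V. (u a)\<^sup>2) \<le> 0" using that t by (simp add: mult_le_0_iff)
    then have "(\<Sum>a\<in>V. (u a)\<^sup>2) = 0" by (simp add: antisym sum_nonneg)
    then show ?thesis using V by (simp add: sum_nonneg_eq_0_iff)
  qed
  have "\<exists>\<phi>. \<forall>a\<in>?W. (\<Sum>b\<in>?W. N a b * \<phi> b) = 1"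
  proof (rule linear_system_solvable)
    fix u assume *: "\<And>a. a \<in> ?W \<Longrightarrow> (\<Sum>b\<in>?W. N a b * u b) = 0"
    \<comment> \<open>Resetting the value at \<open>v\<close> is harmless because the system only
      involves \<open>?W\<close>, and it brings \<open>u'\<close> under the energy bound.\<close>
    define u' where "u' = u(v := 0)"
    have u'v: "u' v = 0" by (simp add: u'_def)
    have "(\<Sum>b\<in>?W. N a b * u' b) = 0" if "a \<in> ?W" for a
      unfolding *[OF that, symmetric] by (rule sum.cong) (auto simp: u'_def)
    then have "u' a * (\<Sum>y\<in>R `` {a}. u' a - u' y) = t * (u' a)\<^sup>2" if "a \<in> V" for a
      using N[of a u'] u'v that by (cases "a = v") (auto simp: power2_eq_square)
    then have "dirichlet_energy R u' = 2 * t * (\<Sum>a\<in>V. (u' a)\<^sup>2)"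
      unfolding form[symmetric] by (simp add: mult.assoc flip: sum_distrib_left)
    then have "(\<mu> - t) * (\<Sum>a\<in>V. (u' a)\<^sup>2) \<le> 0" using \<mu>[of u', OF u'v] by (simp add: algebra_simps)
    from zero[OF this] show "\<forall>a\<in>?W. u a = 0" by (auto simp: u'_def split: if_splits)
  qed (use V in simp)
  then obtain \<phi>0 where \<phi>0: "\<forall>a\<in>?W. (\<Sum>b\<in>?W. N a b * \<phi>0 b) = 1" by blast
  define \<phi> where "\<phi> = \<phi>0(v := 0)"
  have \<phi>v: "\<phi> v = 0" by (simp add: \<phi>_def)
  have "(\<Sum>b\<in>?W. N a b * \<phi> b) = 1" if "a \<in> ?W" for a
    unfolding \<phi>0[rule_format, OF that, symmetric] by (rule sum.cong) (auto simp: \<phi>_def)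
  then have eq: "(\<Sum>y\<in>R `` {a}. \<phi> a - \<phi> y) = t * \<phi> a + 1" if "a \<in> ?W" for a
    using N[of _ \<phi>, OF that \<phi>v] that by simp
  define u where "u a = max (- \<phi> a) 0" for a
  have "dirichlet_energy R u \<le> - (\<Sum>(a, b)\<in>R. (u a - u b) * (\<phi> a - \<phi> b))"
    unfolding dirichlet_energy_def sum_negf[symmetric]
  proof (rule sum_mono, clarify)
    fix a b
    \<comment> \<open>Here \<open>u\<close> is the negative part and \<open>u + \<phi>\<close> the
      positive part of \<open>\<phi>\<close>; with disjoint supports their increments never have the
      same sign.\<close>
    have "(u a - u b) * ((u a - u b) + (\<phi> a - \<phi> b)) \<le> 0"
      unfolding u_def by (auto simp: max_def mult_le_0_iff)
    then show "(u a - u b)\<^sup>2 \<le> - ((u a - u b) * (\<phi> a - \<phi> b))"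
      by (simp add: power2_eq_square distrib_left)
  qed
  also have "\<dots> = - 2 * (\<Sum>a\<in>V. u a * (\<Sum>b\<in>R `` {a}. \<phi> a - \<phi> b))"
    unfolding green_formula[OF V(1) R] by simp
  also have "\<dots> \<le> 2 * t * (\<Sum>a\<in>V. (u a)\<^sup>2)"
  proof -
    have "- t * (u a)\<^sup>2 \<le> u a * (\<Sum>b\<in>R `` {a}. \<phi> a - \<phi> b)" if a: "a \<in> V" for a
    proof (cases "a = v")
      case False
      then have "u a * (\<Sum>b\<in>R `` {a}. \<phi> a - \<phi> b) = t * (u a * \<phi> a) + u a" using eq a by (simp add: algebra_simps)
      moreover have "u a * \<phi> a = - (u a)\<^sup>2" "u a \<ge> 0" unfolding u_def by (auto simp: max_def power2_eq_square)
      ultimately show ?thesis by simp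
    qed (simp add: u_def \<phi>v)
    then have "- t * (\<Sum>a\<in>V. (u a)\<^sup>2) \<le> (\<Sum>a\<in>V. u a * (\<Sum>b\<in>R `` {a}. \<phi> a - \<phi> b))"
      unfolding sum_distrib_left by (intro sum_mono) auto
    then show ?thesis by simp
  qed
  finally have "(\<mu> - t) * (\<Sum>a\<in>V. (u a)\<^sup>2) \<le> 0"
    using \<mu>[of u] by (simp add: u_def \<phi>v algebra_simps)
  from zero[OF this] have nonneg: "\<phi> a \<ge> 0" if "a \<in> V" for a
    using that by (auto simp: u_def max_def split: if_splits)
  have pos: "\<phi> a > 0" if a: "a \<in> ?W" for a
  proof (rule ccontr)
    assume "\<not> ?thesis"
    then have "\<phi> a = 0" using nonneg[of a] a by simp
    \<comment> \<open>At a zero of \<open>\<phi>\<close> the left side of the equation is at most 0,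
      while the right side is 1.\<close>
    moreover have "(\<Sum>y\<in>R `` {a}. - \<phi> y) \<le> 0"
      using R(1) nonneg by (intro sum_nonpos) auto
    ultimately show False using eq[OF a] by simp
  qed
  show thesis
    by (rule that[of \<phi>]) (use \<phi>v pos eq in auto)
qed

section \<open>Token graphs and superkites\<close>

lemma pverts_token_graph: "pverts (token_graph k G) = k_subsets (pverts G) k"
  unfolding token_graph_def k_subsets_def by (simp add: Let_def)

text \<open>Two sets of equal size differ by equally many elements on each side, so a symmetric
  difference of two distinct vertices splits into one leaving and one arriving token. Symmetry of
  the arcs lets the orientation follow the token.\<close>

lemma parcs_token_graph:
  assumes "pair_graph G"
  shows "(A, B) \<in> parcs (token_graph k G) \<longleftrightarrow>
    A \<in> k_subsets (pverts G) k \<and> B \<in> k_subsets (pverts G) k \<and>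
    (\<exists>a b. (a, b) \<in> parcs G \<and> A - B = {a} \<and> B - A = {b})"
proof -
  interpret pair_graph G by fact
  have "\<exists>a b. (a, b) \<in> parcs G \<and> A - B = {a} \<and> B - A = {b}"
    if A: "A \<in> k_subsets (pverts G) k" and B: "B \<in> k_subsets (pverts G) k"
      and ab: "(a, b) \<in> parcs G" "(A - B) \<union> (B - A) = {a, b}" for a b
  proof -
    have fin: "finite A" "finite B"
      using A B finite_subset[OF _ pair_finite_verts] by (auto simp: k_subsets_def)
    have "card A = card B" using A B by (simp add: k_subsets_def)
    then have eq: "card (A - B) = card (B - A)"
      using fin by (metis card_Diff_subset_Int finite_Int inf_commute)
    have "a \<noteq> b" using pair_no_loops[OF ab(1)] by simp
    then have "card (A - B) + card (B - A) = 2"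
      using fin ab(2) by (subst card_Un_disjoint[symmetric]) auto
    with eq have "card (A - B) = 1" "card (B - A) = 1" by auto
    then obtain x y where xy: "A - B = {x}" "B - A = {y}" by (auto simp: card_1_singleton_iff)
    then have "{x, y} = {a, b}" using ab(2) by auto
    then have "(x, y) = (a, b) \<or> (x, y) = (b, a)" by (auto simp: doubleton_eq_iff)
    then have "(x, y) \<in> parcs G" using ab(1) arcs_symmetric by auto
    with xy show ?thesis by blast
  qed
  moreover have "(A - B) \<union> (B - A) = {a, b}" if "A - B = {a}" "B - A = {b}" for a b
    using that by auto
  ultimately show ?thesis
    unfolding token_graph_def k_subsets_def by (auto simp: Let_def) blast+
qed

lemma pair_graph_token_graph:
  assumes "pair_graph G"
  shows "pair_graph (token_graph k G)"
proof -
  interpret pair_graph G by fact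
  let ?T = "token_graph k G"
  note arcs = parcs_token_graph[OF assms] and verts = pverts_token_graph
  have sub: "parcs ?T \<subseteq> pverts ?T \<times> pverts ?T" using arcs verts by fast
  have fin: "finite (pverts ?T)" unfolding verts by simp
  have "(B, A) \<in> parcs ?T" if "(A, B) \<in> parcs ?T" for A B
    using that arcs_symmetric unfolding arcs by blast
  then have "symmetric (with_proj ?T)" by (auto simp: symmetric_def sym_def)
  moreover have "A \<noteq> B" if "(A, B) \<in> parcs ?T" for A B
    using that unfolding arcs by auto
  ultimately show ?thesis
    using sub fin finite_subset[OF sub] by unfold_locales auto
qed

text \<open>An arc of the token graph amounts to an arc \<open>(a, b)\<close> of \<open>G\<close>
  with a configuration that occupies \<open>a\<close> and not \<open>b\<close>; the two set
  differences recover the arc.\<close>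

lemma dirichlet_energy_token_graph:
  assumes "pair_graph G"
  shows "dirichlet_energy (parcs (token_graph k G)) f = token_energy (parcs G) (pverts G) k f"
proof -
  interpret pair_graph G by fact
  note arcs = parcs_token_graph[OF assms]
  let ?S = "\<lambda>e. {A. A \<in> k_subsets (pverts G) k \<and> fst e \<in> A \<and> snd e \<notin> A}"
  have "token_energy (parcs G) (pverts G) k f
      = (\<Sum>(e, A)\<in>(SIGMA e:parcs G. ?S e). (f A - f (insert (snd e) (A - {fst e})))\<^sup>2)"
    unfolding token_energy_def by (subst sum.Sigma[symmetric]) (auto simp: case_prod_beta)
  also have "\<dots> = (\<Sum>(A, B)\<in>parcs (token_graph k G). (f A - f B)\<^sup>2)"
  proof (rule sum.reindex_bij_witness[of _ "\<lambda>(A, B). ((the_elem (A - B), the_elem (B - A)), A)"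
        "\<lambda>(e, A). (A, insert (snd e) (A - {fst e}))"])
    fix x assume "x \<in> (SIGMA e:parcs G. ?S e)"
    then obtain a b A where x: "x = ((a, b), A)" and ab: "(a, b) \<in> parcs G"
      and A: "A \<in> k_subsets (pverts G) k" "a \<in> A" "b \<notin> A" by auto
    have fin: "finite A" using A finite_subset[OF _ pair_finite_verts] by (auto simp: k_subsets_def)
    have D: "A - insert b (A - {a}) = {a}" "insert b (A - {a}) - A = {b}" using A by auto
    have "card A > 0" using fin A card_gt_0_iff by blast
    then have "insert b (A - {a}) \<in> k_subsets (pverts G) k"
      using A fin in_arcsD2[OF ab] by (auto simp: k_subsets_def card_insert_if card_Diff_singleton)
    then show "(case x of (e, A) \<Rightarrow> (A, insert (snd e) (A - {fst e}))) \<in> parcs (token_graph k G)"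
      unfolding x using A ab D by (simp add: arcs)
    show "(case (case x of (e, A) \<Rightarrow> (A, insert (snd e) (A - {fst e}))) of
        (A, B) \<Rightarrow> ((the_elem (A - B), the_elem (B - A)), A)) = x"
      unfolding x using D by simp
  next
    fix y assume "y \<in> parcs (token_graph k G)"
    then obtain A B where y: "y = (A, B)" and AB: "(A, B) \<in> parcs (token_graph k G)" by (cases y) auto
    then obtain a b where ab: "A \<in> k_subsets (pverts G) k" "(a, b) \<in> parcs G" "A - B = {a}" "B - A = {b}"
      unfolding arcs by blast
    then show "(case y of (A, B) \<Rightarrow> ((the_elem (A - B), the_elem (B - A)), A)) \<in> (SIGMA e:parcs G. ?S e)"
      unfolding y by auto
    have "insert b (A - {a}) = B" using ab by auto
    then show "(case (case y of (A, B) \<Rightarrow> ((the_elem (A - B), the_elem (B - A)), A)) of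
        (e, A) \<Rightarrow> (A, insert (snd e) (A - {fst e}))) = y"
      unfolding y using ab by simp
  qed auto
  finally show ?thesis unfolding dirichlet_energy_def by simp
qed

text \<open>\<open>supersolution_exists\<close> needs \<open>t\<close> strictly below
  \<open>\<mu>\<close>. If the Rayleigh quotient of \<open>f\<close> were smaller than
  \<open>\<mu>\<close>, a \<open>t\<close> between the two would contradict the bound for
  \<open>t\<close>.\<close>

theorem token_energy_ge_grounded_eigenvalue:
  fixes f :: "'a set \<Rightarrow> real"
  assumes V: "finite V" "v \<in> V" and R: "R \<subseteq> V \<times> V" "sym R" and \<mu>0: "\<mu> \<ge> 0"
    and \<mu>: "\<And>u. u v = 0 \<Longrightarrow> 2 * \<mu> * (\<Sum>a\<in>V. (u a)\<^sup>2) \<le> dirichlet_energy R u"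
    and f: "(\<Sum>A\<in>k_subsets V k. f A) = 0"
  shows "2 * \<mu> * (\<Sum>A\<in>k_subsets V k. (f A)\<^sup>2) \<le> token_energy R V k f"
proof (rule ccontr)
  let ?S = "\<Sum>A\<in>k_subsets V k. (f A)\<^sup>2" and ?E = "token_energy R V k f"
  assume neg: "\<not> ?thesis"
  have E: "?E \<ge> 0" by (rule token_energy_nonneg)
  have S: "?S > 0"
    using neg E \<mu>0 by (smt (verit) mult_nonneg_nonneg mult_eq_0_iff sum_nonneg zero_le_power2)
  \<comment> \<open>Half-way between the Rayleigh quotient of \<open>f\<close> and
    \<open>\<mu>\<close>.\<close>
  define t where "t = (?E / (2 * ?S) + \<mu>) / 2"
  have "?E / (2 * ?S) < \<mu>" using neg S by (simp add: pos_divide_less_eq mult.commute mult.left_commute)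
  moreover have "?E / (2 * ?S) \<ge> 0" using E S by simp
  ultimately have t: "t < \<mu>" "t \<ge> 0" unfolding t_def using \<mu>0 by auto
  obtain \<phi> where \<phi>: "\<phi> v = (0 :: real)" "\<forall>z\<in>V - {v}. \<phi> z > 0"
      "\<forall>z\<in>V - {v}. t * \<phi> z \<le> (\<Sum>y\<in>R `` {z}. \<phi> z - \<phi> y)"
    using supersolution_exists[OF V R \<mu> t(1)] by blast
  have "2 * t * ?S \<le> ?E"
    by (rule token_energy_ge_of_supersolution[where \<phi> = \<phi> and v = v]) (use V R t f \<phi> in auto)
  moreover have "2 * t * ?S = ?E / 2 + \<mu> * ?S"
    unfolding t_def using S by (simp add: field_simps)
  ultimately show False using neg by simp
qed

text \<open>The grounded bound at \<open>v\<close> controls both spectral gaps from below. From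
  above, \<open>u\<close> is a trial function for \<open>G\<close>, and its lift is one for the
  token graph: lifting scales energy and squared norm by the same constant.\<close>

theorem algebraic_connectivity_token_graph_eq:
  fixes G :: "'a pair_pre_digraph"
  assumes G: "pair_graph G" and v: "v \<in> pverts G" and k: "1 \<le> k" "k < card (pverts G)" and \<mu>0: "\<mu> \<ge> 0"
    and \<mu>: "\<And>u. u v = 0 \<Longrightarrow> 2 * \<mu> * (\<Sum>a\<in>pverts G. (u a)\<^sup>2) \<le> dirichlet_energy (parcs G) u"
    and u: "(\<Sum>a\<in>pverts G. u a) = 0" "(\<Sum>a\<in>pverts G. (u a)\<^sup>2) \<noteq> 0"
      "dirichlet_energy (parcs G) u \<le> 2 * \<mu> * (\<Sum>a\<in>pverts G. (u a)\<^sup>2)"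
  shows "algebraic_connectivity G = \<mu>" "algebraic_connectivity (token_graph k G) = \<mu>"
proof -
  interpret pair_graph G by fact
  let ?V = "pverts G" and ?R = "parcs G"
  let ?n = "card ?V"
  have V: "finite ?V" by (rule pair_finite_verts)
  have R: "?R \<subseteq> ?V \<times> ?V" using in_arcsD1 in_arcsD2 by auto
  have sym: "sym ?R" using arcs_symmetric by (auto intro: symI)
  show "algebraic_connectivity G = \<mu>"
  proof (rule algebraic_connectivity_eqI[OF G _ \<mu>0 _ u])
    show "2 \<le> ?n" using k by simp
    fix f :: "'a \<Rightarrow> real" assume f: "(\<Sum>a\<in>?V. f a) = 0"
    \<comment> \<open>Grounding by a shift: the energy is unchanged and the sum of squares can only
      grow.\<close>
    have "(\<Sum>a\<in>?V. (f a - f v)\<^sup>2) = (\<Sum>a\<in>?V. (f a)\<^sup>2 - 2 * f v * f a + (f v)\<^sup>2)"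
      by (rule sum.cong) (auto simp: power2_eq_square algebra_simps)
    also have "\<dots> = (\<Sum>a\<in>?V. (f a)\<^sup>2) + real ?n * (f v)\<^sup>2"
      using f by (simp add: sum.distrib sum_subtractf flip: sum_distrib_left)
    finally have "2 * \<mu> * (\<Sum>a\<in>?V. (f a)\<^sup>2) \<le> 2 * \<mu> * (\<Sum>a\<in>?V. (f a - f v)\<^sup>2)"
      using \<mu>0 by (simp add: mult_left_mono)
    also have "\<dots> \<le> dirichlet_energy ?R (\<lambda>a. f a - f v)" by (rule \<mu>) simp
    also have "\<dots> = dirichlet_energy ?R f" by (simp add: dirichlet_energy_def)
    finally show "2 * \<mu> * (\<Sum>a\<in>?V. (f a)\<^sup>2) \<le> dirichlet_energy ?R f" .
  qed
  let ?c = "real ((?n - 2) choose (k - 1))"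
  have c: "?c > 0" using k by simp
  let ?u = "\<lambda>A. \<Sum>a\<in>A. u a"
  show "algebraic_connectivity (token_graph k G) = \<mu>"
  proof (rule algebraic_connectivity_eqI[OF pair_graph_token_graph[OF G] _ \<mu>0, where u = ?u];
      (unfold pverts_token_graph dirichlet_energy_token_graph[OF G])?)
    have "card (k_subsets ?V k) = ?n choose k"
      unfolding k_subsets_def by (rule n_subsets[OF V])
    \<comment> \<open>Pascal's rule exhibits two positive summands, so the token graph has a second
      eigenvalue.\<close>
    also have "\<dots> = ((?n - 1) choose (k - 1)) + ((?n - 1) choose k)"
      using k choose_reduce_nat[of ?n k] by simp
    moreover have "((?n - 1) choose (k - 1)) > 0" "((?n - 1) choose k) > 0" using k by auto
    ultimately show "2 \<le> card (k_subsets ?V k)" by linarith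
  next
    show "2 * \<mu> * (\<Sum>A\<in>k_subsets ?V k. (f A)\<^sup>2) \<le> token_energy ?R ?V k f"
      if "(\<Sum>A\<in>k_subsets ?V k. f A) = 0" for f
      by (rule token_energy_ge_grounded_eigenvalue[OF V v R sym \<mu>0 \<mu> that])
  next
    show "(\<Sum>A\<in>k_subsets ?V k. ?u A) = 0" by (rule sum_lift_zero[OF V k(1) u(1)])
    note sq = sum_lift_squared[OF V k(1) u(1)]
    show "(\<Sum>A\<in>k_subsets ?V k. (?u A)\<^sup>2) \<noteq> 0" unfolding sq using c u(2) by simp
    \<comment> \<open>With remainder \<open>w = 0\<close> the decomposition formula gives the energy
      of a pure lift.\<close>
    have "token_energy ?R ?V k ?u = ?c * dirichlet_energy ?R u"
      using token_energy_lift_add[OF V R k(1), of "\<lambda>_. 0" u] by (simp add: token_energy_def)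
    also have "\<dots> \<le> ?c * (2 * \<mu> * (\<Sum>a\<in>?V. (u a)\<^sup>2))"
      using u(3) by (intro mult_left_mono) auto
    finally show "token_energy ?R ?V k ?u \<le> 2 * \<mu> * (\<Sum>A\<in>k_subsets ?V k. (?u A)\<^sup>2)"
      unfolding sq by (simp add: mult.left_commute mult.assoc)
  qed
qed

section \<open>The superkite\<close>

lemma dirichlet_energy_map_prod:
  assumes "inj_on f V" "R \<subseteq> V \<times> V"
  shows "dirichlet_energy (map_prod f f ` R) u = dirichlet_energy R (\<lambda>b. u (f b))"
proof -
  have "inj_on (map_prod f f) R"
    using map_prod_inj_on[OF assms(1,1)] assms(2) by (rule inj_on_subset)
  then show ?thesis
    unfolding dirichlet_energy_def by (simp add: sum.reindex case_prod_beta)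
qed

text \<open>The common value is the smallest eigenvalue of \<open>Q\<close> grounded at its root;
  two vertices in \<open>Q\<close> keep the grounded matrix nonempty, so that this eigenvalue
  exists. The added edges form a set \<open>F\<close> of arcs; that the result is symmetric and
  loop-free is part of \<open>G'\<close> being a \<open>pair_graph\<close>.\<close>

theorem theorem4p9:
  fixes G H G' :: "'a pair_pre_digraph" and Q :: "'b pair_pre_digraph"
    and v :: 'a and r :: 'b and s k :: nat and F :: "('a \<times> 'a) set"
  assumes "superkite G H v Q r s"
    and "2 \<le> card (pverts Q)"
    and "\<not> complete_digraph (card (pverts H)) (with_proj H)"
    and "1 \<le> k" and "k \<le> card (pverts H) - 1"
    and "algebraic_connectivity H = algebraic_connectivity (token_graph k H)"
    and "min_eigenvalue (laplacian_on (pverts H - {v}) H)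
           \<ge> min_eigenvalue (laplacian_on (pverts Q - {r}) Q)"
    and "pair_graph G'"
    and "pverts G' = pverts G"
    and "F \<subseteq> pverts H \<times> pverts H" and "parcs G' = parcs G \<union> F"
  shows "algebraic_connectivity G' = algebraic_connectivity (token_graph k G')"
proof -
  from assms(1) obtain T where H: "pair_graph H" and vH: "v \<in> pverts H" and tree: "undirected_tree Q"
    and rQ: "r \<in> pverts Q" and s: "2 \<le> s"
    and iso: "\<forall>i<s. rooted_iso Q r (T i) v"
    and TH: "\<forall>i<s. pverts (T i) \<inter> pverts H = {v}"
    and TT: "\<forall>i<s. \<forall>j<s. i \<noteq> j \<longrightarrow> pverts (T i) \<inter> pverts (T j) = {v}"
    and GV: "pverts G = pverts H \<union> (\<Union>i<s. pverts (T i))"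
    and GR: "parcs G = parcs H \<union> (\<Union>i<s. parcs (T i))"
    unfolding superkite_def by (elim conjE exE) (rule that; assumption)
  from tree have Q: "pair_graph Q" unfolding undirected_tree_def by simp
  interpret H: pair_graph H by fact
  interpret Q: pair_graph Q by fact
  interpret G': pair_graph G' by fact
  from iso have "\<forall>i. \<exists>f. i < s \<longrightarrow> bij_betw f (pverts Q) (pverts (T i)) \<and> f r = v \<and>
      parcs (T i) = map_prod f f ` parcs Q"
    unfolding rooted_iso_def by blast
  from choice[OF this] obtain f where "\<forall>i. i < s \<longrightarrow> bij_betw (f i) (pverts Q) (pverts (T i)) \<and> f i r = v \<and>
      parcs (T i) = map_prod (f i) (f i) ` parcs Q" ..
  then have f: "\<And>i. i < s \<Longrightarrow> bij_betw (f i) (pverts Q) (pverts (T i))"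
    and fr: "\<And>i. i < s \<Longrightarrow> f i r = v"
    and fR: "\<And>i. i < s \<Longrightarrow> parcs (T i) = map_prod (f i) (f i) ` parcs Q"
    by auto
  have V: "pverts G' = pverts H \<union> (\<Union>i<s. pverts (T i))" using GV assms(9) by simp
  have R: "parcs G' = (parcs H \<union> F) \<union> (\<Union>i<s. parcs (T i))" using GR assms(11) by auto
  have QR: "parcs Q \<subseteq> pverts Q \<times> pverts Q" using Q.in_arcsD1 Q.in_arcsD2 by auto
  have HR: "parcs H \<subseteq> pverts H \<times> pverts H" using H.in_arcsD1 H.in_arcsD2 by auto
  have TR: "parcs (T i) \<subseteq> pverts (T i) \<times> pverts (T i)" if "i < s" for i
    unfolding fR[OF that] using QR bij_betwE[OF f[OF that]] by auto
  have finT: "finite (parcs (T i))" if "i < s" for i unfolding fR[OF that] by simp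
  \<comment> \<open>The head and the copies meet only in \<open>v\<close>, so a common arc of two of
    them would be a loop at \<open>v\<close>; hence their arc sets are disjoint.\<close>
  have loops: "(a, a) \<notin> parcs G'" for a using G'.pair_no_loops[of "(a, a)"] by auto

  let ?W = "pverts Q - {r}" and ?\<mu> = "min_eigenvalue (laplacian_on (pverts Q - {r}) Q)"
  have W: "?W \<noteq> {}"
  proof
    assume "?W = {}"
    then have "pverts Q \<subseteq> {r}" by auto
    from card_mono[OF _ this] assms(2) show False by simp
  qed
  have HV: "pverts H - {v} \<noteq> {}"
  proof
    assume "pverts H - {v} = {}"
    then have "pverts H \<subseteq> {v}" by auto
    from card_mono[OF _ this] assms(4,5) show False by simp
  qed
  have ET: "dirichlet_energy (parcs (T i)) u = dirichlet_energy (parcs Q) (\<lambda>b. u (f i b))"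
    if "i < s" for i u
    unfolding fR[OF that] using f[OF that] QR by (intro dirichlet_energy_map_prod) (auto simp: bij_betw_def)
  \<comment> \<open>Functions vanishing at \<open>v\<close> do not see the shared root, so their
    sums split over the head and the copies, each copy pulled back to \<open>Q\<close>.\<close>
  have sumV: "(\<Sum>a\<in>pverts G'. h a) = (\<Sum>a\<in>pverts H - {v}. h a) + (\<Sum>i<s. \<Sum>b\<in>?W. h (f i b))"
    if h: "h v = 0" for h :: "'a \<Rightarrow> real"
  proof -
    have bij: "bij_betw (f i) ?W (pverts (T i) - {v})" if "i < s" for i
      using bij_betw_DiffI[OF f[OF that], of "{r}" "{v}"] rQ fr[OF that] bij_betwE[OF f[OF that]]
      by auto
    have fin: "finite (pverts (T i))" if "i < s" for i
      using bij_betw_finite[OF f[OF that]] by simp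
    have "(\<Sum>a\<in>pverts G'. h a) = (\<Sum>a\<in>(pverts H - {v}) \<union> (\<Union>i<s. pverts (T i) - {v}). h a)"
      using h fin by (intro sum.mono_neutral_right) (auto simp: V)
    also have "\<dots> = (\<Sum>a\<in>pverts H - {v}. h a) + (\<Sum>a\<in>(\<Union>i<s. pverts (T i) - {v}). h a)"
      using TH fin by (intro sum.union_disjoint) auto
    also have "(\<Sum>a\<in>(\<Union>i<s. pverts (T i) - {v}). h a) = (\<Sum>i<s. \<Sum>a\<in>pverts (T i) - {v}. h a)"
      using TT fin by (intro sum.UNION_disjoint) auto
    also have "\<dots> = (\<Sum>i<s. \<Sum>b\<in>?W. h (f i b))"
      by (intro sum.cong refl sum.reindex_bij_betw[symmetric] bij) simp
    finally show ?thesis .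
  qed

  have EU: "dirichlet_energy (\<Union>i<s. parcs (T i)) u = (\<Sum>i<s. dirichlet_energy (parcs (T i)) u)" for u
  proof -
    have "parcs (T i) \<inter> parcs (T j) = {}" if ij: "i < s" "j < s" "i \<noteq> j" for i j
    proof -
      have "parcs (T i) \<inter> parcs (T j) \<subseteq> {(v, v)}"
        using TR[OF ij(1)] TR[OF ij(2)] TT ij by fastforce
      then show ?thesis using loops[of v] ij R by blast
    qed
    then show ?thesis
      unfolding dirichlet_energy_def using finT by (intro sum.UNION_disjoint) auto
  qed
  have lower: "2 * ?\<mu> * (\<Sum>a\<in>pverts G'. (u a)\<^sup>2) \<le> dirichlet_energy (parcs G') u" if u: "u v = 0" for u
  proof -
    have "2 * ?\<mu> * (\<Sum>a\<in>pverts G'. (u a)\<^sup>2)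
        = 2 * ?\<mu> * (\<Sum>a\<in>pverts H - {v}. (u a)\<^sup>2) + (\<Sum>i<s. 2 * ?\<mu> * (\<Sum>b\<in>?W. (u (f i b))\<^sup>2))"
      using sumV[of "\<lambda>a. (u a)\<^sup>2"] u by (simp add: distrib_left sum_distrib_left)
    also have "\<dots> \<le> dirichlet_energy (parcs H) u + (\<Sum>i<s. dirichlet_energy (parcs (T i)) u)"
    proof (intro add_mono sum_mono)
      \<comment> \<open>The eigenvalue hypothesis on the head enters here: on \<open>H\<close> the
        bound holds with a constant at least as large.\<close>
      have "2 * ?\<mu> * (\<Sum>a\<in>pverts H - {v}. (u a)\<^sup>2)
          \<le> 2 * min_eigenvalue (laplacian_on (pverts H - {v}) H) * (\<Sum>a\<in>pverts H - {v}. (u a)\<^sup>2)"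
        using assms(7) by (intro mult_right_mono) (auto intro: sum_nonneg)
      also have "\<dots> \<le> dirichlet_energy (parcs H) u"
        by (rule min_eigenvalue_laplacian_on(1)[OF H _ HV]) (use u in auto)
      finally show "2 * ?\<mu> * (\<Sum>a\<in>pverts H - {v}. (u a)\<^sup>2) \<le> dirichlet_energy (parcs H) u" .
      show "2 * ?\<mu> * (\<Sum>b\<in>?W. (u (f i b))\<^sup>2) \<le> dirichlet_energy (parcs (T i)) u" if "i \<in> {..<s}" for i
        using that fr u unfolding ET[of i u, OF that[simplified]]
        by (intro min_eigenvalue_laplacian_on(1)[OF Q _ W]) auto
    qed
    also have "(\<Sum>i<s. dirichlet_energy (parcs (T i)) u) = dirichlet_energy (\<Union>i<s. parcs (T i)) u"
      by (rule EU[symmetric])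
    also have "dirichlet_energy (parcs H) u + dirichlet_energy (\<Union>i<s. parcs (T i)) u
        = dirichlet_energy (parcs H \<union> (\<Union>i<s. parcs (T i))) u"
    proof -
      have "parcs H \<inter> parcs (T i) = {}" if i: "i < s" for i
      proof -
        have "parcs H \<inter> parcs (T i) \<subseteq> {(v, v)}" using HR TR[OF i] TH i by fastforce
        then show ?thesis using loops[of v] i R by blast
      qed
      then show ?thesis
        unfolding dirichlet_energy_def using finT by (intro sum.union_disjoint[symmetric]) auto
    qed
    \<comment> \<open>New edges in the head only add nonnegative terms.\<close>
    also have "\<dots> \<le> dirichlet_energy (parcs G') u"
      unfolding dirichlet_energy_def R using G'.pair_finite_arcs R by (intro sum_mono2) auto
    finally show ?thesis .
  qed

  from min_eigenvalue_laplacian_on(2)[OF Q _ W] obtain \<psi>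
    where \<psi>: "\<forall>b. b \<notin> ?W \<longrightarrow> \<psi> b = 0" "(\<Sum>b\<in>?W. (\<psi> b)\<^sup>2) > 0"
      "dirichlet_energy (parcs Q) \<psi> = 2 * ?\<mu> * (\<Sum>b\<in>?W. (\<psi> b)\<^sup>2)" by blast
  have \<mu>0: "?\<mu> \<ge> 0"
    using dirichlet_energy_nonneg[of "parcs Q" \<psi>] \<psi>(2,3) by (simp add: zero_le_mult_iff)
  \<comment> \<open>The copies numbered 0 and 1 carry opposite signs and the others 0, which makes
    the trial function mean-zero; \<open>2 \<le> s\<close> provides both copies.\<close>
  define c :: "nat \<Rightarrow> real" where "c i = (if i = 0 then 1 else if i = 1 then - 1 else 0)" for i
  have c01: "(\<Sum>i<s. g (c i)) = g 1 + g (- 1)" if "g 0 = 0" for g :: "real \<Rightarrow> real"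
  proof -
    have "(\<Sum>i<s. g (c i)) = (\<Sum>i\<in>{0, 1}. g (c i))"
      using s that by (intro sum.mono_neutral_right) (auto simp: c_def)
    then show ?thesis by (simp add: c_def)
  qed
  define g where "g i = inv_into (pverts Q) (f i)" for i
  have g: "g i (f i b) = b" if "i < s" "b \<in> pverts Q" for i b
    unfolding g_def using f[OF that(1)] that(2) by (simp add: bij_betw_def inv_into_f_f)
  have s01: "0 < s" "1 < s" using s by auto
  have \<psi>r: "\<psi> r = 0" using \<psi>(1) by simp
  have gv: "g i v = r" if "i < s" for i using g[OF that rQ] fr[OF that] by simp
  \<comment> \<open>At \<open>v\<close>, which lies in both copies, the value is unambiguous because
    \<open>\<psi>\<close> vanishes at the root.\<close>
  define u where "u a = (if a \<in> pverts (T 0) then \<psi> (g 0 a)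
      else if a \<in> pverts (T 1) then - \<psi> (g 1 a) else 0)" for a
  have uv: "u v = 0" unfolding u_def using gv s01 \<psi>r by simp
  have uf: "u (f i b) = c i * \<psi> b" if ib: "i < s" "b \<in> pverts Q" for i b
  proof (cases "b = r")
    case True
    then show ?thesis using fr ib uv \<psi>r by simp
  next
    case False
    have fT: "f i b \<in> pverts (T i)" using bij_betwE[OF f[OF ib(1)]] ib(2) by blast
    have "f i b \<noteq> v"
      using False g[OF ib] gv[OF ib(1)] by auto
    then have "f i b \<notin> pverts (T j)" if "j < s" "j \<noteq> i" for j
      using TT ib(1) that fT by blast
    then show ?thesis
      using fT g[OF ib] s01 by (auto simp: u_def c_def)
  qed
  have uH: "u a = 0" if "a \<in> pverts H" for a
  proof (cases "a = v")
    case False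
    then have "a \<notin> pverts (T 0)" "a \<notin> pverts (T 1)" using TH s01 that by blast+
    then show ?thesis by (simp add: u_def)
  qed (simp add: uv)
  have usum: "(\<Sum>a\<in>pverts G'. u a) = 0"
    using sumV[of u] uv uH uf c01[of "\<lambda>x. x"]
    by (simp add: sum_distrib_left[symmetric] sum_distrib_right[symmetric])
  have usq: "(\<Sum>a\<in>pverts G'. (u a)\<^sup>2) = 2 * (\<Sum>b\<in>?W. (\<psi> b)\<^sup>2)"
    using sumV[of "\<lambda>a. (u a)\<^sup>2"] uv uH uf c01[of "\<lambda>x. x\<^sup>2"]
    by (simp add: power_mult_distrib sum_distrib_left[symmetric] sum_distrib_right[symmetric])
  \<comment> \<open>Subadditivity over arc sets suffices for an upper bound.\<close>
  have "dirichlet_energy (parcs G') u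
      \<le> dirichlet_energy (parcs H \<union> F) u + dirichlet_energy (\<Union>i<s. parcs (T i)) u"
  proof -
    have "finite (parcs H \<union> F)" "finite (\<Union>i<s. parcs (T i))"
      using G'.pair_finite_arcs R by (metis finite_Un)+
    then show ?thesis
      unfolding dirichlet_energy_def R by (subst sum_Un) (auto intro!: sum_nonneg)
  qed
  \<comment> \<open>Every arc of \<open>H\<close> and \<open>F\<close> joins head vertices, where
    \<open>u\<close> is 0, so added edges leave the energy of the trial function unchanged.\<close>
  also have "dirichlet_energy (parcs H \<union> F) u = 0"
    unfolding dirichlet_energy_def using HR assms(10) uH by (intro sum.neutral) auto
  also have "dirichlet_energy (\<Union>i<s. parcs (T i)) u = (\<Sum>i<s. dirichlet_energy (parcs (T i)) u)"
    by (rule EU)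
  also have "\<dots> = (\<Sum>i<s. (c i)\<^sup>2 * dirichlet_energy (parcs Q) \<psi>)"
  proof (rule sum.cong[OF refl])
    fix i assume "i \<in> {..<s}"
    then have i: "i < s" by simp
    show "dirichlet_energy (parcs (T i)) u = (c i)\<^sup>2 * dirichlet_energy (parcs Q) \<psi>"
      unfolding ET[OF i] unfolding dirichlet_energy_def sum_distrib_left
      using uf[OF i] QR by (intro sum.cong) (auto simp: power_mult_distrib right_diff_distrib[symmetric])
  qed
  also have "\<dots> = 2 * ?\<mu> * (\<Sum>a\<in>pverts G'. (u a)\<^sup>2)"
    using c01[of "\<lambda>x. x\<^sup>2"] unfolding usq \<psi>(3) by (simp add: sum_distrib_right[symmetric])
  finally have uE: "dirichlet_energy (parcs G') u \<le> 2 * ?\<mu> * (\<Sum>a\<in>pverts G'. (u a)\<^sup>2)" by simp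

  have "card (pverts H) \<le> card (pverts G')"
    using V G'.pair_finite_verts by (intro card_mono) auto
  then have kn: "k < card (pverts G')" using assms(4,5) by linarith
  have vG: "v \<in> pverts G'" using V vH by simp
  show ?thesis
    using algebraic_connectivity_token_graph_eq[OF assms(8) vG assms(4) kn \<mu>0 lower usum _ uE] usq \<psi>(2)
    by simp
qed

end
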